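(* Let $R$ be an irreducible, reduced root system of dimension $n$ with Weyl group $\mathcal W(R)$ and canonical basis $\mathcal B=\{\alpha_1,\dots,\alpha_n\}$ (simple roots, in Bourbaki's numbering), and let $\rho$ be the $n$-dimensional integral representation of $\mathcal W(R)$, on the lattice with basis $\mathcal B$, generated by the reflections associated to the elements of $\mathcal B$. Then the family of $\rho$-decomposable principally polarized abelian varieties is one-dimensional, and is parameterized by the family of Riemann matrices $$\mathbb H(R)=\{Z_\tau=\tau Z_0 : \tau\in\mathbb H_1\};$$ that is, for every $\tau \in\mathbb H_1$ the p.p.a.v. with Riemann matrix $Z_\tau$ is $\rho$-decomposable, and every $\rho$-decomposable p.p.a.v. is isomorphic as a p.p.a.v. to one with Riemann matrix $Z_\tau$ for some $\tau\in\mathbb H_1$. Here $Z_0$ is the following symmetric $n\times n$ matrix. $\mathbf{A_n}$: $(Z_0)_{ij}=\frac{1}{n+1}\, i\,(n+1-j)$ for $i\le j$. $\mathbf{B_n}$: $(Z_0)_{ij}=i$ for $i\le j$. $\mathbf{C_n}$: $(Z_0)_{ij}=i$ for $i\le j\le n-1$; $(Z_0)_{in}=\frac i2$ for $i\le n-1$; $(Z_0)_{nn}=\frac n4$. $\mathbf{D_n}$: $(Z_0)_{ij}=i$ for $i\le j\le n-2$; $(Z_0)_{i,n-1}=(Z_0)_{in}=\frac i2$ for $i\le n-2$; $(Z_0)_{n-1,n-1}=(Z_0)_{nn}=\frac n4$; $(Z_0)_{n-1,n}=\frac{n-2}{4}$. $\mathbf{E_6}$: $Z_0=\frac13\begin{pmatrix}4&3&5&6&4&2\\3&6&6&9&6&3\\5&6&10&12&8&4\\6&9&12&18&12&6\\4&6&8&12&10&5\\2&3&4&6&5&4\end{pmatrix}$.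 $\mathbf{E_7}$: $Z_0=\frac12\begin{pmatrix}4&4&6&8&6&4&2\\4&7&8&12&9&6&3\\6&8&12&16&12&8&4\\8&12&16&24&18&12&6\\6&9&12&18&15&10&5\\4&6&8&12&10&8&4\\2&3&4&6&5&4&3\end{pmatrix}$. $\mathbf{E_8}$: $Z_0=\begin{pmatrix}4&5&7&10&8&6&4&2\\5&8&10&15&12&9&6&3\\7&10&14&20&16&12&8&4\\10&15&20&30&24&18&12&6\\8&12&16&24&20&15&10&5\\6&9&12&18&15&12&8&4\\4&6&8&12&10&8&6&3\\2&3&4&6&5&4&3&2\end{pmatrix}$. $\mathbf{F_4}$: $Z_0=\begin{pmatrix}1&\frac32&2&1\\\frac32&3&4&2\\2&4&6&3\\1&2&3&2\end{pmatrix}$. $\mathbf{G_2}$: $Z_0=\frac13\begin{pmatrix}6&3\\3&2\end{pmatrix}$.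
   Context: The irreducible reduced root systems are, following Bourbaki, $\mathbf{A_n}$ ($n\ge1$), $\mathbf{B_n}$ ($n\ge2$), $\mathbf{C_n}$ ($n\ge3$), $\mathbf{D_n}$ ($n\ge3$), $\mathbf{E_6},\mathbf{E_7},\mathbf{E_8},\mathbf{F_4},\mathbf{G_2}$, with simple roots numbered as in Bourbaki's Planches I–IX (in $\mathbf{B_n}$ the last simple root is the short one, in $\mathbf{C_n}$ the last is the long one, in $\mathbf{F_4}$ $\alpha_1,\alpha_2$ are long, in $\mathbf{G_2}$ $\alpha_1$ is short; in $\mathbf{E_k}$ the edges of the Dynkin diagram are $\{1,3\},\{2,4\},\{3,4\},\{4,5\},\dots,\{k-1,k\}$). $\mathbb H_n$ is the Siegel upper half space of degree $n$; $\mathbb H_1$ is the upper half plane. A principally polarized abelian variety (p.p.a.v.) of dimension $n$ is a pair $(X,H)$, where $X=V/\Lambda$ is a complex torus of dimension $n$ and $H$ is a positive definite Hermitian form on $V$ whose imaginary part is integer valued and unimodular on $\Lambda$. The p.p.a.v. with Riemann matrix $Z\in\mathbb H_n$ is $\mathbb C^n/(\mathbb Z^n+Z\mathbb Z^n)$ with its standard principal polarization, for which the standard basis of $\mathbb Z^n$ followed by the columns of $Z$ is a symplectic basis. Isomorphism as p.p.a.v.'s means isomorphism of complex tori preserving the polarizations. A p.p.a.v. has a $G$-action if $G$ is a subgroup of the group of automorphisms of the torus $X$ preserving $H$; then $G$ acts on $\Lambda$. For a faithful integral representation $\rho$ of a finite group $G$, a p.p.a.v. $(X=V/\Lambda,H)$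 is $\rho$-decomposable if it has a $G$-action for which there is a direct sum decomposition $\Lambda=L_1\oplus L_2$ with $L_1,L_2$ both $G$-invariant and isotropic for $\Im H$, and with $L_1$ isomorphic as a $\mathbb ZG$-module to $\rho$. *)

theory Defs
  imports
    "HOL-Analysis.Euclidean_Space"
    "HOL-Algebra.Bij"
    "HOL-Algebra.AbelCoset"
    "HOL-Algebra.Generated_Groups"
    "HOL-Library.Countable_Set"
    "Jordan_Normal_Form.VS_Connect"
    "Jordan_Normal_Form.Gauss_Jordan_Elimination"
begin

section \<open>Root systems\<close>

definition reflection :: "'e::real_inner \<Rightarrow> 'e \<Rightarrow> 'e" where
  "reflection a x = x - (2 * inner x a / inner a a) *\<^sub>R a"

definition root_system :: "'e::euclidean_space set \<Rightarrow> bool" where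
  "root_system R \<longleftrightarrow>
     finite R \<and> 0 \<notin> R \<and> Real_Vector_Spaces.span R = UNIV \<and>
     (\<forall>a\<in>R. reflection a ` R = R) \<and>
     (\<forall>a\<in>R. \<forall>b\<in>R. 2 * inner b a / inner a a \<in> \<int>)"

definition reduced_root_system :: "'e::euclidean_space set \<Rightarrow> bool" where
  "reduced_root_system R \<longleftrightarrow>
     root_system R \<and> (\<forall>a\<in>R. \<forall>c. c *\<^sub>R a \<in> R \<longrightarrow> c = 1 \<or> c = - 1)"

definition irreducible_root_system :: "'e::euclidean_space set \<Rightarrow> bool" where
  "irreducible_root_system R \<longleftrightarrow>
     root_system R \<and> R \<noteq> {} \<and>
     \<not> (\<exists>R1 R2. R1 \<noteq> {} \<and> R2 \<noteq> {} \<and> R1 \<inter> R2 = {} \<and> R1 \<union> R2 = R \<and>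
             (\<forall>a\<in>R1. \<forall>b\<in>R2. inner a b = 0))"

definition weyl_group :: "'e::euclidean_space set \<Rightarrow> ('e \<Rightarrow> 'e) monoid" where
  "weyl_group R =
     BijGroup UNIV \<lparr>carrier := generate (BijGroup UNIV) (reflection ` R)\<rparr>"

text \<open>Simple roots are numbered \<open>\<alpha> 1, \<dots>, \<alpha> n\<close>; the values of \<open>\<alpha>\<close>
  outside \<open>{1..n}\<close> are irrelevant.\<close>

definition root_basis :: "'e::euclidean_space set \<Rightarrow> nat \<Rightarrow> (nat \<Rightarrow> 'e) \<Rightarrow> bool" where
  "root_basis R n \<alpha> \<longleftrightarrow>
     \<alpha> ` {1..n} \<subseteq> R \<and> inj_on \<alpha> {1..n} \<and>
     \<not> Real_Vector_Spaces.dependent (\<alpha> ` {1..n}) \<and>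
     (\<forall>b\<in>R. \<exists>c :: nat \<Rightarrow> int. b = (\<Sum>i=1..n. of_int (c i) *\<^sub>R \<alpha> i) \<and>
        ((\<forall>i\<in>{1..n}. c i \<ge> 0) \<or> (\<forall>i\<in>{1..n}. c i \<le> 0)))"

definition basis_lattice :: "nat \<Rightarrow> (nat \<Rightarrow> 'e::euclidean_space) \<Rightarrow> 'e set" where
  "basis_lattice n \<alpha> = {\<Sum>i=1..n. of_int (c i) *\<^sub>R \<alpha> i | c :: nat \<Rightarrow> int. True}"

datatype root_type =
    TypeA nat | TypeB nat | TypeC nat | TypeD nat
  | TypeE6 | TypeE7 | TypeE8 | TypeF4 | TypeG2

fun type_rank :: "root_type \<Rightarrow> nat" where
  "type_rank (TypeA n) = n"
| "type_rank (TypeB n) = n"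
| "type_rank (TypeC n) = n"
| "type_rank (TypeD n) = n"
| "type_rank TypeE6 = 6"
| "type_rank TypeE7 = 7"
| "type_rank TypeE8 = 8"
| "type_rank TypeF4 = 4"
| "type_rank TypeG2 = 2"

fun valid_type :: "root_type \<Rightarrow> bool" where
  "valid_type (TypeA n) \<longleftrightarrow> n \<ge> 1"
| "valid_type (TypeB n) \<longleftrightarrow> n \<ge> 2"
| "valid_type (TypeC n) \<longleftrightarrow> n \<ge> 3"
| "valid_type (TypeD n) \<longleftrightarrow> n \<ge> 3"
| "valid_type _ \<longleftrightarrow> True"

definition path_edges :: "nat \<Rightarrow> nat \<Rightarrow> nat set set" where
  "path_edges k m = {{i, Suc i} | i. k \<le> i \<and> i < m}"

definition simply_laced :: "nat set set \<Rightarrow> nat \<Rightarrow> nat \<Rightarrow> int" where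
  "simply_laced E i j = (if i = j then 2 else if {i, j} \<in> E then - 1 else 0)"

text \<open>Bourbaki's Cartan integers
  \<open>n(\<alpha>\<^sub>i, \<alpha>\<^sub>j) = 2 (\<alpha>\<^sub>i|\<alpha>\<^sub>j) / (\<alpha>\<^sub>j|\<alpha>\<^sub>j)\<close>, for \<open>1 \<le> i, j \<le> n\<close>.
  In the multiply laced types the entry of absolute value greater than 1 has the long root
  as first index and the short root as second index.\<close>

fun cartan_integer :: "root_type \<Rightarrow> nat \<Rightarrow> nat \<Rightarrow> int" where
  "cartan_integer (TypeA n) i j = simply_laced (path_edges 1 n) i j"
| "cartan_integer (TypeB n) i j =
     (if i = n - 1 \<and> j = n then - 2 else simply_laced (path_edges 1 n) i j)"
| "cartan_integer (TypeC n) i j =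
     (if i = n \<and> j = n - 1 then - 2 else simply_laced (path_edges 1 n) i j)"
| "cartan_integer (TypeD n) i j = simply_laced (insert {n - 2, n} (path_edges 1 (n - 1))) i j"
| "cartan_integer TypeE6 i j = simply_laced ({{1, 3}, {2, 4}} \<union> path_edges 3 6) i j"
| "cartan_integer TypeE7 i j = simply_laced ({{1, 3}, {2, 4}} \<union> path_edges 3 7) i j"
| "cartan_integer TypeE8 i j = simply_laced ({{1, 3}, {2, 4}} \<union> path_edges 3 8) i j"
| "cartan_integer TypeF4 i j =
     (if i = 2 \<and> j = 3 then - 2 else simply_laced (path_edges 1 4) i j)"
| "cartan_integer TypeG2 i j =
     (if i = 2 \<and> j = 1 then - 3 else simply_laced (path_edges 1 2) i j)"

definition bourbaki_basis ::
  "root_type \<Rightarrow> 'e::euclidean_space set \<Rightarrow> (nat \<Rightarrow> 'e) \<Rightarrow> bool" where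
  "bourbaki_basis T R \<alpha> \<longleftrightarrow>
     valid_type T \<and> DIM('e) = type_rank T \<and> root_basis R (type_rank T) \<alpha> \<and>
     (\<forall>i\<in>{1..type_rank T}. \<forall>j\<in>{1..type_rank T}.
        2 * inner (\<alpha> i) (\<alpha> j) / inner (\<alpha> j) (\<alpha> j) = of_int (cartan_integer T i j))"

section \<open>Principally polarized abelian varieties\<close>

text \<open>The torus is \<open>V/\<Lambda>\<close> for \<open>V = tangent X\<close>, \<open>\<Lambda> = lattice X\<close>, with Hermitian form
  \<open>herm X\<close> on \<open>V\<close>.\<close>

record 'v polarized_torus =
  tangent :: "(complex, 'v) module"
  lattice :: "'v set"
  herm :: "'v \<Rightarrow> 'v \<Rightarrow> complex"

definition real_basis :: "(complex, 'v) module \<Rightarrow> nat \<Rightarrow> (nat \<Rightarrow> 'v) \<Rightarrow> bool" where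
  "real_basis V m b \<longleftrightarrow>
     b \<in> {..<m} \<rightarrow> carrier V \<and>
     (\<forall>v\<in>carrier V. \<exists>!x :: nat \<Rightarrow> real. x \<in> extensional {..<m} \<and>
        v = (\<Oplus>\<^bsub>V\<^esub>i\<in>{..<m}. complex_of_real (x i) \<odot>\<^bsub>V\<^esub> b i))"

definition full_lattice :: "(complex, 'v) module \<Rightarrow> nat \<Rightarrow> 'v set \<Rightarrow> bool" where
  "full_lattice V n L \<longleftrightarrow>
     (\<exists>b. real_basis V (2 * n) b \<and>
        L = {\<Oplus>\<^bsub>V\<^esub>i\<in>{..<2 * n}. complex_of_int (k i) \<odot>\<^bsub>V\<^esub> b i | k :: nat \<Rightarrow> int. True})"

text \<open>Hermitian forms are conjugate linear in the first and linear in the second argument;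
  with this convention the standard polarization defined below has
  \<open>Im H(e\<^sub>i, Z e\<^sub>j) = \<delta>\<^sub>i\<^sub>j\<close>, as required of a symplectic basis.\<close>

definition hermitian_form :: "(complex, 'v) module \<Rightarrow> ('v \<Rightarrow> 'v \<Rightarrow> complex) \<Rightarrow> bool" where
  "hermitian_form V H \<longleftrightarrow>
     (\<forall>u\<in>carrier V. \<forall>v\<in>carrier V. H v u = cnj (H u v)) \<and>
     (\<forall>u\<in>carrier V. \<forall>v\<in>carrier V. \<forall>w\<in>carrier V. H u (v \<oplus>\<^bsub>V\<^esub> w) = H u v + H u w) \<and>
     (\<forall>u\<in>carrier V. \<forall>v\<in>carrier V. \<forall>c. H u (c \<odot>\<^bsub>V\<^esub> v) = c * H u v)"

definition positive_definite :: "(complex, 'v) module \<Rightarrow> ('v \<Rightarrow> 'v \<Rightarrow> complex) \<Rightarrow> bool" where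
  "positive_definite V H \<longleftrightarrow> (\<forall>v\<in>carrier V. v \<noteq> \<zero>\<^bsub>V\<^esub> \<longrightarrow> Re (H v v) > 0)"

text \<open>Unimodular: \<open>E\<close> induces a bijection from \<open>L\<close> onto \<open>Hom(L, \<int>)\<close>.\<close>

definition unimodular_on ::
  "(complex, 'v) module \<Rightarrow> 'v set \<Rightarrow> ('v \<Rightarrow> 'v \<Rightarrow> real) \<Rightarrow> bool" where
  "unimodular_on V L E \<longleftrightarrow>
     (\<forall>\<phi> :: 'v \<Rightarrow> int. (\<forall>x\<in>L. \<forall>y\<in>L. \<phi> (x \<oplus>\<^bsub>V\<^esub> y) = \<phi> x + \<phi> y) \<longrightarrow>
        (\<exists>!y. y \<in> L \<and> (\<forall>x\<in>L. E y x = of_int (\<phi> x))))"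

definition ppav :: "nat \<Rightarrow> 'v polarized_torus \<Rightarrow> bool" where
  "ppav n X \<longleftrightarrow>
     vectorspace class_ring (tangent X) \<and>
     vectorspace.fin_dim class_ring (tangent X) \<and>
     vectorspace.dim class_ring (tangent X) = n \<and>
     full_lattice (tangent X) n (lattice X) \<and>
     hermitian_form (tangent X) (herm X) \<and>
     positive_definite (tangent X) (herm X) \<and>
     (\<forall>x\<in>lattice X. \<forall>y\<in>lattice X. Im (herm X x y) \<in> \<int>) \<and>
     unimodular_on (tangent X) (lattice X) (\<lambda>x y. Im (herm X x y))"

text \<open>A homomorphism of complex tori (fixing the origin) is represented by its unique
  \<open>\<complex>\<close>-linear lift to the tangent spaces.\<close>

definition ppav_iso :: "('v \<Rightarrow> 'w) \<Rightarrow> 'v polarized_torus \<Rightarrow> 'w polarized_torus \<Rightarrow> bool" where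
  "ppav_iso f X Y \<longleftrightarrow>
     f \<in> module_hom class_ring (tangent X) (tangent Y) \<and>
     bij_betw f (carrier (tangent X)) (carrier (tangent Y)) \<and>
     f ` lattice X = lattice Y \<and>
     (\<forall>u\<in>carrier (tangent X). \<forall>v\<in>carrier (tangent X). herm Y (f u) (f v) = herm X u v)"

definition ppav_isomorphic :: "'v polarized_torus \<Rightarrow> 'w polarized_torus \<Rightarrow> bool" where
  "ppav_isomorphic X Y \<longleftrightarrow> (\<exists>f. ppav_iso f X Y)"

definition ppav_aut :: "'v polarized_torus \<Rightarrow> ('v \<Rightarrow> 'v) monoid" where
  "ppav_aut X = BijGroup (carrier (tangent X))
     \<lparr>carrier := {f \<in> Bij (carrier (tangent X)). ppav_iso f X X}\<rparr>"

definition isotropic :: "'v polarized_torus \<Rightarrow> 'v set \<Rightarrow> bool" where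
  "isotropic X L \<longleftrightarrow> (\<forall>x\<in>L. \<forall>y\<in>L. Im (herm X x y) = 0)"

text \<open>The integral representation \<open>\<rho>\<close> of \<open>G\<close> is given by a lattice \<open>M\<close> in some additive
  group together with the action \<open>act\<close> of \<open>G\<close> on it.\<close>

definition rho_decomposable ::
  "nat \<Rightarrow> ('g, 'c) monoid_scheme \<Rightarrow> 'm::ab_group_add set \<Rightarrow> ('g \<Rightarrow> 'm \<Rightarrow> 'm) \<Rightarrow>
     'v polarized_torus \<Rightarrow> bool" where
  "rho_decomposable n G M act X \<longleftrightarrow>
     ppav n X \<and>
     (\<exists>T. T \<in> hom G (ppav_aut X) \<and> inj_on T (carrier G) \<and>
       (\<exists>L1 L2.
          additive_subgroup L1 (tangent X) \<and> additive_subgroup L2 (tangent X) \<and>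
          L1 <+>\<^bsub>tangent X\<^esub> L2 = lattice X \<and> L1 \<inter> L2 = {\<zero>\<^bsub>tangent X\<^esub>} \<and>
          (\<forall>g\<in>carrier G. T g ` L1 \<subseteq> L1 \<and> T g ` L2 \<subseteq> L2) \<and>
          isotropic X L1 \<and> isotropic X L2 \<and>
          (\<exists>\<psi>. bij_betw \<psi> M L1 \<and>
             (\<forall>x\<in>M. \<forall>y\<in>M. \<psi> (x + y) = \<psi> x \<oplus>\<^bsub>tangent X\<^esub> \<psi> y) \<and>
             (\<forall>g\<in>carrier G. \<forall>x\<in>M. \<psi> (act g x) = T g (\<psi> x)))))"

section \<open>Riemann matrices\<close>

definition upper_half_plane :: "complex set" where
  "upper_half_plane = {\<tau>. Im \<tau> > 0}"

definition siegel_space :: "nat \<Rightarrow> complex mat set" where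
  "siegel_space n = {Z \<in> carrier_mat n n. transpose_mat Z = Z \<and>
     (\<forall>x\<in>carrier_vec n. x \<noteq> 0\<^sub>v n \<longrightarrow> x \<bullet> (map_mat Im Z *\<^sub>v x) > 0)}"

text \<open>The standard principal polarization is
  \<open>H(v, w) = v\<^sup>* (Im Z)\<^sup>-\<^sup>1 w\<close>, where \<open>v\<^sup>*\<close> is the conjugate transpose of \<open>v\<close>.\<close>

definition riemann_ppav :: "nat \<Rightarrow> complex mat \<Rightarrow> complex vec polarized_torus" where
  "riemann_ppav n Z = \<lparr>
     tangent = module_vec TYPE(complex) n,
     lattice = {map_vec complex_of_int a + Z *\<^sub>v map_vec complex_of_int b | a b.
                  a \<in> carrier_vec n \<and> b \<in> carrier_vec n},
     herm = (\<lambda>v w. (map_mat complex_of_real (the (mat_inverse (map_mat Im Z))) *\<^sub>v w) \<bullet>c v)\<rparr>"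

text \<open>Symmetric matrix with entry \<open>f i j\<close> in position \<open>(i, j)\<close>, \<open>1 \<le> i \<le> j \<le> n\<close>
  (matrices themselves are indexed from 0).\<close>

definition sym_mat :: "nat \<Rightarrow> (nat \<Rightarrow> nat \<Rightarrow> real) \<Rightarrow> real mat" where
  "sym_mat n f = mat n n (\<lambda>(i, j). f (Suc (min i j)) (Suc (max i j)))"

fun Z0 :: "root_type \<Rightarrow> real mat" where
  "Z0 (TypeA n) = sym_mat n (\<lambda>i j. 1 / (real n + 1) * (real i * (real n + 1 - real j)))"
| "Z0 (TypeB n) = sym_mat n (\<lambda>i j. real i)"
| "Z0 (TypeC n) = sym_mat n (\<lambda>i j.
     if j \<le> n - 1 then real i else if i \<le> n - 1 then real i / 2 else real n / 4)"
| "Z0 (TypeD n) = sym_mat n (\<lambda>i j.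
     if j \<le> n - 2 then real i else if i \<le> n - 2 then real i / 2
     else if i = j then real n / 4 else (real n - 2) / 4)"
| "Z0 TypeE6 = (1 / 3) \<cdot>\<^sub>m mat_of_rows_list 6
    [[4, 3,  5,  6,  4, 2],
     [3, 6,  6,  9,  6, 3],
     [5, 6, 10, 12,  8, 4],
     [6, 9, 12, 18, 12, 6],
     [4, 6,  8, 12, 10, 5],
     [2, 3,  4,  6,  5, 4]]"
| "Z0 TypeE7 = (1 / 2) \<cdot>\<^sub>m mat_of_rows_list 7
    [[4,  4,  6,  8,  6,  4, 2],
     [4,  7,  8, 12,  9,  6, 3],
     [6,  8, 12, 16, 12,  8, 4],
     [8, 12, 16, 24, 18, 12, 6],
     [6,  9, 12, 18, 15, 10, 5],
     [4,  6,  8, 12, 10,  8, 4],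
     [2,  3,  4,  6,  5,  4, 3]]"
| "Z0 TypeE8 = mat_of_rows_list 8
    [[ 4,  5,  7, 10,  8,  6,  4, 2],
     [ 5,  8, 10, 15, 12,  9,  6, 3],
     [ 7, 10, 14, 20, 16, 12,  8, 4],
     [10, 15, 20, 30, 24, 18, 12, 6],
     [ 8, 12, 16, 24, 20, 15, 10, 5],
     [ 6,  9, 12, 18, 15, 12,  8, 4],
     [ 4,  6,  8, 12, 10,  8,  6, 3],
     [ 2,  3,  4,  6,  5,  4,  3, 2]]"
| "Z0 TypeF4 = mat_of_rows_list 4
    [[    1, 3 / 2, 2, 1],
     [3 / 2,     3, 4, 2],
     [    2,     4, 6, 3],
     [    1,     2, 3, 2]]"
| "Z0 TypeG2 = (1 / 3) \<cdot>\<^sub>m mat_of_rows_list 2 [[6, 3], [3, 2]]"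

definition Z_tau :: "root_type \<Rightarrow> complex \<Rightarrow> complex mat" where
  "Z_tau T \<tau> = \<tau> \<cdot>\<^sub>m map_mat complex_of_real (Z0 T)"

end

theory Submission
  imports Defs
begin

text \<open>
  Everything follows from one fact about the matrices: up to a positive scalar \<open>lam\<close>, the matrix
  \<open>Z\<^sub>0\<close> is the inverse of the Gram matrix of the simple roots. For each type \<open>Z\<^sub>0\<close> times the Cartan
  matrix is a diagonal matrix \<open>D\<close> with positive entries
  (\<open>Z0_diagonalizes_cartan_matrix\<close>). The Gram matrix is the Cartan matrix with its columns rescaled
  by half the squared root lengths, so it remains to see that \<open>D\<close> compensates these lengths; both
  are determined, up to a common factor, by the ratios of opposite Cartan integers along the edges
  of the connected Dynkin diagram (\<open>bourbaki_basis_root_frame\<close>). The rest of the argument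
  is uniform in the type and takes place in the Euclidean space \<open>E\<close> of the root system with its root lattice \<open>M\<close> and
  the multiple \<open>P\<close> of the dual lattice on which the roots take values in \<open>lam \<int>\<close>.

  For the existence part, the basis of simple roots identifies \<open>\<complex>\<^sup>n\<close> with \<open>E + \<i> E\<close>. The
  columns of \<open>Z\<^sub>0\<close> become the basis of \<open>P\<close> dual to the simple roots, the lattice of the variety
  becomes \<open>M + \<tau> P\<close>, and its polarization is the Hermitian extension of the inner product divided
  by \<open>lam Im \<tau>\<close>. The Weyl group acts on \<open>E\<close> by isometries preserving \<open>M\<close>, hence also \<open>P\<close>, so its
  complex linear extension acts on the variety and respects the decomposition
  (\<open>rho_decomposable_X\<close>).

  Conversely, let \<open>\<Lambda> = L\<^sub>1 + L\<^sub>2\<close> be a decomposition with an equivariant isomorphism from \<open>M\<close> onto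
  \<open>L\<^sub>1\<close>. Unimodularity and isotropy make \<open>L\<^sub>2\<close> the dual of \<open>L\<^sub>1\<close>, hence equivariantly isomorphic to
  \<open>P\<close>. Extending both isomorphisms to \<open>E\<close> gives equivariant real linear maps \<open>\<Psi>\<close> and \<open>\<Delta>\<close> from
  \<open>E\<close> to the tangent space \<open>V\<close>, whose images together span \<open>V\<close> over the reals. For a simple root
  \<open>a\<close> the \<open>(-1)\<close>-eigenspace in \<open>V\<close> of the reflection in \<open>a\<close> is a complex subspace, and it is
  spanned over the reals by \<open>\<Psi> a\<close> and \<open>\<Delta> a\<close>; therefore it is a complex line and \<open>\<Delta> a = c \<Psi> a\<close>
  for a complex number \<open>c\<close>. Equivariance under the other reflections shows that adjacent simple
  roots have the same \<open>c\<close>, so that \<open>\<Delta> = \<tau> \<Psi>\<close> for a single number \<open>\<tau>\<close>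
  (\<open>Delta_eq_tau_Psi\<close>). Positivity of the polarization gives \<open>Im \<tau> > 0\<close>, and \<open>\<Lambda> = \<Psi> M + \<tau> \<Psi> P\<close>
  is the lattice of the Riemann matrix \<open>\<tau> Z\<^sub>0\<close>.

  The family is genuinely one-dimensional because the values of the Hermitian form on pairs of
  lattice vectors form a countable isomorphism invariant, and \<open>\<tau>\<close> can be computed from two of these
  values (\<open>tau_from_herm_values\<close>).
\<close>


section \<open>Cartan matrices and the matrices \<open>Z\<^sub>0\<close>\<close>

lemma doubleton_mem_path_edges:
  "{i, j} \<in> path_edges k m \<longleftrightarrow> k \<le> i \<and> i < m \<and> j = Suc i \<or> k \<le> j \<and> j < m \<and> i = Suc j"
  unfolding path_edges_def by (auto simp: doubleton_eq_iff)

text \<open>Multiplying by the Cartan matrix of a path is taking a discrete second difference; the piecewise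
  linear rows of \<open>Z\<^sub>0\<close> are the Green functions of this operator, which is why the product is
  diagonal in the classical types.\<close>

lemma sum_simply_laced_path:
  fixes z :: "nat \<Rightarrow> real"
  assumes "m \<le> n" "j < n"
  shows "(\<Sum>k<n. z k * of_int (simply_laced (path_edges 1 m) (Suc k) (Suc j))) =
    2 * z j - (if 0 < j \<and> j < m then z (j - 1) else 0) - (if Suc j < m then z (Suc j) else 0)"
proof -
  have "z k * of_int (simply_laced (path_edges 1 m) (Suc k) (Suc j)) =
      (if k = j then 2 * z j else 0)
      - (if k = j - 1 then if 0 < j \<and> j < m then z (j - 1) else 0 else 0)
      - (if k = Suc j then if Suc j < m then z (Suc j) else 0 else 0)" for k
    unfolding simply_laced_def doubleton_mem_path_edges by auto
  then show ?thesis
    using assms by (simp only: sum_subtractf sum.delta finite_lessThan) auto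
qed

definition diagonalizes :: "real mat \<Rightarrow> nat \<Rightarrow> (nat \<Rightarrow> nat \<Rightarrow> int) \<Rightarrow> (nat \<Rightarrow> real) \<Rightarrow> bool" where
  "diagonalizes Z n a d \<longleftrightarrow> (\<forall>j<n. 0 < d j) \<and>
     (\<forall>i<n. \<forall>j<n. (\<Sum>k<n. Z $$ (i, k) * of_int (a (Suc k) (Suc j))) = (if i = j then d j else 0))"

lemma sym_mat_index: "i < n \<Longrightarrow> j < n \<Longrightarrow> sym_mat n f $$ (i, j) = f (Suc (min i j)) (Suc (max i j))"
  by (simp add: sym_mat_def)

text \<open>The formula for the entries gives the value 0 one step beyond the last column, so the second
  difference has the same form at that end of the diagram as inside.\<close>

lemma diagonalizes_A: 
  "diagonalizes (Z0 (TypeA n)) n (cartan_integer (TypeA n)) (\<lambda>_. 1)"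
proof -
  define c where "c = 1 / (real n + 1)"
  have Z: "Z0 (TypeA n) $$ (i, k) = real (Suc (min i k)) - real (Suc (min i k)) * real (Suc (max i k)) * c"
    if "i < n" "k < n" for i k
    using that by (simp add: sym_mat_index c_def field_simps)
  have "(\<Sum>k<n. Z0 (TypeA n) $$ (i, k) * of_int (cartan_integer (TypeA n) (Suc k) (Suc j))) = (if i = j then 1 else 0)"
    if ij: "i < n" "j < n" for i j
  proof -
    have last: "(if Suc j < n then Z0 (TypeA n) $$ (i, Suc j) else 0)
       = real (Suc (min i (Suc j))) - real (Suc (min i (Suc j))) * real (Suc (max i (Suc j))) * c"
    proof (cases "Suc j < n")
      case False
      with ij have "n = Suc j" "i \<le> j" by auto
      then show ?thesis by (simp add: c_def min_def max_def)
    qed (use Z ij in simp)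
    show ?thesis
      unfolding cartan_integer.simps sum_simply_laced_path[OF order_refl ij(2)] last
      using ij
      by (cases i j rule: linorder_cases; cases j)
        (auto simp del: Z0.simps simp: Z min_def max_def algebra_simps)
  qed
  then show ?thesis by (simp add: diagonalizes_def)
qed

text \<open>In the remaining classical types the Cartan matrix differs from that of a path in one or two
  entries only; the sum splits into the second difference along the path and a correction for these
  entries.\<close>

lemma diagonalizes_B: 
  assumes "n \<ge> 2"
  shows "diagonalizes (Z0 (TypeB n)) n (cartan_integer (TypeB n)) (\<lambda>j. if Suc j = n then 2 else 1)"
proof -
  have "(\<Sum>k<n. Z0 (TypeB n) $$ (i, k) * of_int (cartan_integer (TypeB n) (Suc k) (Suc j)))
     = (if i = j then if Suc j = n then 2 else 1 else 0)"
    if "i < n" "j < n" for i j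
  proof -
    have a: "cartan_integer (TypeB n) (Suc k) (Suc j) = simply_laced (path_edges 1 n) (Suc k) (Suc j)
        - (if k = n - 2 then if Suc j = n then 1 else 0 else 0)" for k
      using assms by (auto simp: simply_laced_def doubleton_mem_path_edges)
    show ?thesis
      unfolding a of_int_diff right_diff_distrib sum_subtractf sum_simply_laced_path[OF order_refl that(2)]
      using that assms
      by (cases i j rule: linorder_cases; cases j; cases "Suc j = n")
        (auto simp: sym_mat_index min_def max_def field_simps of_nat_diff if_distrib cong: if_cong)
  qed
  then show ?thesis by (simp add: diagonalizes_def)
qed

lemma diagonalizes_C: 
  assumes "n \<ge> 3"
  shows "diagonalizes (Z0 (TypeC n)) n (cartan_integer (TypeC n)) (\<lambda>j. if Suc j = n then 1 / 2 else 1)"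
proof -
  obtain m where m: "n = Suc (Suc (Suc m))"
    using assms by (metis numeral_3_eq_3 Suc_le_D Suc_le_mono)
  have Z: "Z0 (TypeC n) $$ (i, k) = (if i = n - 1 \<and> k = n - 1 then real n / 4
      else if i = n - 1 then real (Suc k) / 2 else if k = n - 1 then real (Suc i) / 2
      else real (Suc (min i k)))"
    if "i < n" "k < n" for i k
    using that by (auto simp: sym_mat_index min_def max_def)
  have "(\<Sum>k<n. Z0 (TypeC n) $$ (i, k) * of_int (cartan_integer (TypeC n) (Suc k) (Suc j)))
     = (if i = j then if Suc j = n then 1 / 2 else 1 else 0)"
    if ij: "i < n" "j < n" for i j
  proof -
    have a: "cartan_integer (TypeC n) (Suc k) (Suc j) = simply_laced (path_edges 1 n) (Suc k) (Suc j)
        - (if k = n - 1 then if Suc (Suc j) = n then 1 else 0 else 0)" for k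
      using assms by (auto simp: simply_laced_def doubleton_mem_path_edges)
    have "(\<Sum>k<n. Z0 (TypeC n) $$ (i, k) * of_int (cartan_integer (TypeC n) (Suc k) (Suc j)))
      = 2 * Z0 (TypeC n) $$ (i, j) - (if 0 < j \<and> j < n then Z0 (TypeC n) $$ (i, j - 1) else 0)
        - (if Suc j < n then Z0 (TypeC n) $$ (i, Suc j) else 0)
        - (if Suc (Suc j) = n then Z0 (TypeC n) $$ (i, n - 1) else 0)"
      unfolding a of_int_diff right_diff_distrib sum_subtractf sum_simply_laced_path[OF order_refl ij(2)]
      using m by (simp add: if_distrib cong: if_cong del: Z0.simps)
    also have "\<dots> = (if i = j then if Suc j = n then 1 / 2 else 1 else 0)"
    proof -
      consider "j = Suc (Suc m)" | "j = Suc m" | "j < Suc m" using ij m by linarith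
      then show ?thesis
      proof cases
        case 1
        with ij m show ?thesis by (simp add: Z[unfolded m] field_simps del: Z0.simps)
      next
        case 2
        with ij m show ?thesis by (cases "i = Suc (Suc m)"; cases "i = Suc m") (simp_all add: Z[unfolded m] field_simps del: Z0.simps)
      next
        case 3
        with ij m show ?thesis
          by (cases i j rule: linorder_cases; cases j; cases "i = Suc (Suc m)") (simp_all add: Z[unfolded m] field_simps del: Z0.simps)
      qed
    qed
    finally show ?thesis .
  qed
  then show ?thesis by (simp add: diagonalizes_def del: Z0.simps cartan_integer.simps)
qed

lemma diagonalizes_D: 
  assumes "n \<ge> 3"
  shows "diagonalizes (Z0 (TypeD n)) n (cartan_integer (TypeD n)) (\<lambda>_. 1)"
proof -
  obtain m where m: "n = Suc (Suc (Suc m))"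
    using assms by (metis numeral_3_eq_3 Suc_le_D Suc_le_mono)
  \<comment> \<open>Here \<open>l = n - 3\<close>: the indices beyond \<open>l\<close> are the two end nodes of the fork.\<close>
  have Z: "Z0 (TypeD n) $$ (i, k) = (if l < i \<and> l < k then if i = k then real n / 4 else (real n - 2) / 4
      else if l < i then real (Suc k) / 2 else if l < k then real (Suc i) / 2
      else real (Suc (min i k)))"
    if "i < n" "k < n" "n = Suc (Suc (Suc l))" for i k l n
    using that by (auto simp: sym_mat_index min_def max_def)
  have "(\<Sum>k<n. Z0 (TypeD n) $$ (i, k) * of_int (cartan_integer (TypeD n) (Suc k) (Suc j)))
     = (if i = j then 1 else 0)"
    if ij: "i < n" "j < n" for i j
  proof -
    have a: "cartan_integer (TypeD n) (Suc k) (Suc j) = simply_laced (path_edges 1 (n - 1)) (Suc k) (Suc j)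
        - (if k = n - 3 then if Suc j = n then 1 else 0 else 0)
        - (if k = n - 1 then if Suc (Suc (Suc j)) = n then 1 else 0 else 0)" for k
      unfolding m by (auto simp: simply_laced_def doubleton_mem_path_edges doubleton_eq_iff)
    have "(\<Sum>k<n. Z0 (TypeD n) $$ (i, k) * of_int (cartan_integer (TypeD n) (Suc k) (Suc j)))
      = 2 * Z0 (TypeD n) $$ (i, j) - (if 0 < j \<and> j < n - 1 then Z0 (TypeD n) $$ (i, j - 1) else 0)
        - (if Suc j < n - 1 then Z0 (TypeD n) $$ (i, Suc j) else 0)
        - (if Suc j = n then Z0 (TypeD n) $$ (i, n - 3) else 0)
        - (if Suc (Suc (Suc j)) = n then Z0 (TypeD n) $$ (i, n - 1) else 0)"
      unfolding a of_int_diff right_diff_distrib sum_subtractf sum_simply_laced_path[OF diff_le_self ij(2)]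
      using m by (simp add: if_distrib cong: if_cong del: Z0.simps)
    also have "\<dots> = (if i = j then 1 else 0)"
    proof -
      have i: "i = Suc (Suc m) \<or> i = Suc m \<or> i = m \<or> i < m" using ij m by linarith
      consider "j = Suc (Suc m)" | "j = Suc m" | "j = m" | "j < m" using ij m by linarith
      then show ?thesis
      proof cases
        case 1
        from i ij m 1 show ?thesis by (elim disjE) (simp_all add: Z field_simps del: Z0.simps)
      next
        case 2
        from i ij m 2 show ?thesis by (elim disjE) (simp_all add: Z field_simps del: Z0.simps)
      next
        case 3
        from i ij m 3 show ?thesis
          by (cases m) (elim disjE; simp add: Z field_simps del: Z0.simps)+
      next
        case 4
        from i ij m 4 show ?thesis
          by (cases i j rule: linorder_cases; cases j) 
            (elim disjE; simp add: Z field_simps del: Z0.simps)+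
      qed
    qed
    finally show ?thesis .
  qed
  then show ?thesis by (simp add: diagonalizes_def del: Z0.simps cartan_integer.simps)
qed

lemmas exceptional_simps = diagonalizes_def simply_laced_def doubleton_mem_path_edges doubleton_eq_iff
  mat_of_rows_list_def numeral_eq_Suc All_less_Suc

lemma diagonalizes_G2: 
  "diagonalizes (Z0 TypeG2) 2 (cartan_integer TypeG2) (\<lambda>j. if j = 0 then 1 else 1 / 3)"
  by (simp add: exceptional_simps)

lemma diagonalizes_F4: 
  "diagonalizes (Z0 TypeF4) 4 (cartan_integer TypeF4) (\<lambda>j. if j < 2 then 1 / 2 else 1)"
  by (simp add: exceptional_simps)

lemma diagonalizes_E6: 
  "diagonalizes (Z0 TypeE6) 6 (cartan_integer TypeE6) (\<lambda>_. 1)"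
  by (simp add: exceptional_simps)

lemma diagonalizes_E7: 
  "diagonalizes (Z0 TypeE7) 7 (cartan_integer TypeE7) (\<lambda>_. 1)"
  by (simp add: exceptional_simps)

lemma diagonalizes_E8: 
  "diagonalizes (Z0 TypeE8) 8 (cartan_integer TypeE8) (\<lambda>_. 1)"
  by (simp add: exceptional_simps)

lemma Z0_diagonalizes_cartan_matrix:
  assumes "valid_type T"
  shows "\<exists>d. diagonalizes (Z0 T) (type_rank T) (cartan_integer T) d"
  using assms
  by (cases T) (auto simp del: Z0.simps cartan_integer.simps
      intro!: exI diagonalizes_A diagonalizes_B diagonalizes_C diagonalizes_D diagonalizes_E6
        diagonalizes_E7 diagonalizes_E8 diagonalizes_F4 diagonalizes_G2)

lemma Z0_carrier: "Z0 T \<in> carrier_mat (type_rank T) (type_rank T)"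
  by (cases T) (auto simp: sym_mat_def mat_of_rows_list_def)

lemma Z0_symmetric:
  assumes "i < type_rank T" "j < type_rank T"
  shows "Z0 T $$ (i, j) = Z0 T $$ (j, i)"
proof -
  have fin: "\<forall>i<type_rank T. \<forall>j<type_rank T. Z0 T $$ (i, j) = Z0 T $$ (j, i)"
    if "T \<in> {TypeE6, TypeE7, TypeE8, TypeF4, TypeG2}"
    using that by (elim insertE emptyE) (simp_all add: mat_of_rows_list_def numeral_eq_Suc All_less_Suc)
  show ?thesis
    using assms fin
    by (cases T) (auto simp: sym_mat_index min.commute max.commute
        simp del: Z0.simps(5-9) type_rank.simps(5-9))
qed

text \<open>Connectedness is stated as an induction principle: a property that spreads along the edges of
  the diagram holds everywhere. The nodes of a path are reached one after the other; type \<open>D\<close> has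
  one additional edge at the end, and in type \<open>E\<close> the nodes are reached in the order
  1, 3, 4, then 2 and 5, 6, and so on.\<close>

lemma dynkin_diagram_connected:
  assumes valid: "valid_type T" and P0: "P 0"
    and step: "\<And>i j. \<lbrakk>i < type_rank T; j < type_rank T; cartan_integer T (Suc i) (Suc j) \<noteq> 0; P i\<rbrakk> \<Longrightarrow> P j"
    and i: "i < type_rank T"
  shows "P i"
proof -
  have path: "P j" if "m \<le> type_rank T" "\<And>i. Suc i < m \<Longrightarrow> cartan_integer T (Suc i) (Suc (Suc i)) \<noteq> 0" "j < m"
    for m j
    using that(3)
  proof (induction j)
    case (Suc j)
    then show ?case using that(1) step[of j "Suc j"] that(2)[of j] by auto
  qed (use P0 in simp)
  have E: "P i"
    if r: "type_rank T = k" "6 \<le> k" "k \<le> 8"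
      and c: "\<And>i j. cartan_integer T i j = simply_laced ({{1, 3}, {2, 4}} \<union> path_edges 3 k) i j"
    for k
  proof -
    have 2: "P 2" using step[of 0 2] P0 r by (simp add: c simply_laced_def)
    have 3: "P j" if "2 \<le> j" "j < k" for j
      using that
    proof (induction j rule: dec_induct)
      case (step j)
      then show ?case
        using assms(3)[of j "Suc j"] r by (auto simp: c simply_laced_def doubleton_mem_path_edges)
    qed (rule 2)
    have 1: "P 1" using step[of 3 1] 3[of 3] r
      by (simp add: c simply_laced_def doubleton_eq_iff numeral_eq_Suc)
    show ?thesis using P0 1 3[of i] i r by (cases "i = 0"; cases "i = 1") auto
  qed
  show ?thesis
  proof (cases T)
    case (TypeD n)
    have p: "P j" if "j < n - 1" for j
      by (rule path[OF _ _ that])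
        (use TypeD valid in \<open>auto simp: simply_laced_def doubleton_mem_path_edges doubleton_eq_iff\<close>)
    have "P (n - 1)"
      using p[of "n - 3"] step[of "n - 3" "n - 1"] TypeD valid
      by (auto simp: simply_laced_def doubleton_eq_iff Suc_diff_Suc numeral_eq_Suc)
    then show ?thesis using p[of i] i TypeD by (cases "i = n - 1") auto
  next
    case TypeE6
    then show ?thesis using E[of 6] by simp
  next
    case TypeE7
    then show ?thesis using E[of 7] by simp
  next
    case TypeE8
    then show ?thesis using E[of 8] by simp
  qed (rule path[OF order_refl _ i]; simp add: simply_laced_def doubleton_mem_path_edges)+
qed

section \<open>Root lattice, dual lattice and Weyl group\<close>

lemma reflection_linear: "linear (reflection a)"
  unfolding reflection_def
  by (rule linearI) (simp_all add: inner_add_left algebra_simps add_divide_distrib)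

lemma inner_reflection: "inner (reflection a x) (reflection a y) = inner x y"
  by (cases "a = 0") (simp_all add: reflection_def inner_diff_left inner_diff_right inner_commute field_simps)

lemma reflection_reflection: "reflection a (reflection a x) = x"
  by (cases "a = 0") (simp_all add: reflection_def inner_diff_left field_simps)

text \<open>Maps out of a lattice are only known to be additive; this is the passage to linear algebra,
  for values in any real vector space.\<close>

lemma additive_int_combination:
  fixes f :: "'a::real_vector \<Rightarrow> 'b::real_vector" and e :: "nat \<Rightarrow> 'a"
  assumes N: "0 \<in> N" "\<And>x y. x \<in> N \<Longrightarrow> y \<in> N \<Longrightarrow> x + y \<in> N" "\<And>x. x \<in> N \<Longrightarrow> - x \<in> N"
    and f: "\<And>x y. x \<in> N \<Longrightarrow> y \<in> N \<Longrightarrow> f (x + y) = f x + f y"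
    and e: "\<And>i. i < n \<Longrightarrow> e i \<in> N"
  shows "f (\<Sum>i<n. of_int (c i) *\<^sub>R e i) = (\<Sum>i<n. of_int (c i) *\<^sub>R f (e i))"
proof -
  have f0: "f 0 = 0" using f[OF N(1) N(1)] by simp
  have fm: "f (- x) = - f x" if "x \<in> N" for x
    using f[OF that N(3)[OF that]] f0 by (simp add: eq_neg_iff_add_eq_0 add.commute)
  have nat: "of_nat k *\<^sub>R x \<in> N \<and> f (of_nat k *\<^sub>R x) = of_nat k *\<^sub>R f x" if "x \<in> N" for k x
    using that by (induction k) (simp_all add: N f f0 scaleR_add_left)
  have int: "of_int k *\<^sub>R x \<in> N \<and> f (of_int k *\<^sub>R x) = of_int k *\<^sub>R f x" if "x \<in> N" for k x
    using nat[OF that] N(3) fm by (cases k rule: int_cases2) simp_all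
  have "(\<Sum>i<m. of_int (c i) *\<^sub>R e i) \<in> N \<and>
      f (\<Sum>i<m. of_int (c i) *\<^sub>R e i) = (\<Sum>i<m. of_int (c i) *\<^sub>R f (e i))" if "m \<le> n" for m
    using that by (induction m) (simp_all add: N f f0 int e)
  then show ?thesis by blast
qed

text \<open>The inverses occurring in the generated group are harmless, because the generators are
  involutions.\<close>

lemma weyl_group_properties:
  assumes R: "root_system R" and g: "g \<in> carrier (weyl_group R)"
  shows "linear g \<and> (\<forall>x y. inner (g x) (g y) = inner x y) \<and> g ` R = R \<and> bij g"
proof -
  have refl: "linear (reflection a) \<and> (\<forall>x y. inner (reflection a x) (reflection a y) = inner x y)
      \<and> reflection a ` R = R \<and> bij (reflection a)" if "a \<in> R" for a
    using R that reflection_linear inner_reflection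
    by (auto simp: root_system_def intro!: o_bij[of "reflection a"] ext simp: reflection_reflection)
  have bij: "reflection a \<in> Bij UNIV" if "a \<in> R" for a
    using refl[OF that] by (simp add: Bij_def)
  have refl_inv: "m_inv (BijGroup UNIV) (reflection a) = reflection a" if "a \<in> R" for a
    using bij[OF that]
    by (intro group.inv_equality group_BijGroup)
      (auto simp: BijGroup_def compose_def reflection_reflection)
  have "g \<in> generate (BijGroup UNIV) (reflection ` R)"
    using g by (simp add: weyl_group_def)
  then show ?thesis
  proof (induction rule: generate.induct)
    case one
    then show ?case by (simp add: BijGroup_def bij_def inj_on_def surj_def linear_iff)
  next
    case (incl h)
    then show ?case using refl by auto
  next
    case (inv h)
    then show ?case using refl refl_inv by (metis imageE)
  next
    case (eng h1 h2)
    then have "h1 \<otimes>\<^bsub>BijGroup UNIV\<^esub> h2 = h1 \<circ> h2"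
      by (auto simp: BijGroup_def Bij_def compose_def fun_eq_iff)
    moreover have "(h1 \<circ> h2) ` R = R" using eng by (metis image_comp)
    moreover have "linear (h1 \<circ> h2)" "bij (h1 \<circ> h2)"
      using eng by (auto intro: linear_compose bij_comp)
    ultimately show ?case using eng by (simp add: o_def)
  qed
qed

lemma weyl_group_mult:
  assumes "root_system R" "g \<in> carrier (weyl_group R)" "h \<in> carrier (weyl_group R)"
  shows "g \<otimes>\<^bsub>weyl_group R\<^esub> h = g \<circ> h"
proof -
  have "g \<in> Bij UNIV" "h \<in> Bij UNIV"
    using weyl_group_properties assms by (auto simp: Bij_def)
  then show ?thesis
    by (simp add: weyl_group_def BijGroup_def compose_def fun_eq_iff)
qed

text \<open>The type of the root system enters the geometry only through the following data: a matrix
  inverse to the Gram matrix of the simple roots up to the factor \<open>lam\<close>, and the connectedness of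
  the graph of non-orthogonal simple roots. The simple roots are renumbered from 0, like the rows of a matrix.\<close>

locale root_frame =
  fixes R :: "'e::euclidean_space set" and n :: nat and \<alpha> :: "nat \<Rightarrow> 'e"
    and Z :: "real mat" and lam :: real
  assumes root_system: "root_system R"
    and basis: "root_basis R n \<alpha>"
    and n_pos: "0 < n"
    and Z_carrier: "Z \<in> carrier_mat n n"
    and Z_symmetric: "\<And>i j. \<lbrakk>i < n; j < n\<rbrakk> \<Longrightarrow> Z $$ (i, j) = Z $$ (j, i)"
    and lam_pos: "0 < lam"
    and Z_gram: "\<And>i j. \<lbrakk>i < n; j < n\<rbrakk> \<Longrightarrow>
      (\<Sum>k<n. Z $$ (i, k) * inner (\<alpha> (Suc k)) (\<alpha> (Suc j))) = (if i = j then lam else 0)"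
    and connected: "\<And>P i. \<lbrakk>P 0; \<And>i j. \<lbrakk>i < n; j < n; inner (\<alpha> (Suc i)) (\<alpha> (Suc j)) \<noteq> 0; P i\<rbrakk> \<Longrightarrow> P j; i < n\<rbrakk>
      \<Longrightarrow> P i"
begin

abbreviation b :: "nat \<Rightarrow> 'e" where "b i \<equiv> \<alpha> (Suc i)"

text \<open>The columns of the symmetric matrix \<open>Z\<close>, read in the basis of simple roots, form the basis dual
  to the simple roots for the inner product divided by \<open>lam\<close>. For this scaled product, coordinates
  in each of the two bases are therefore products with the vectors of the other one.\<close>

definition dual :: "nat \<Rightarrow> 'e" where "dual i = (\<Sum>k<n. Z $$ (i, k) *\<^sub>R b k)"

definition coord :: "'e \<Rightarrow> nat \<Rightarrow> real" where "coord x i = inner (dual i) x / lam"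

definition dual_coord :: "'e \<Rightarrow> nat \<Rightarrow> real" where "dual_coord x i = inner x (b i) / lam"

definition root_lattice :: "'e set" where "root_lattice = {x. \<forall>i<n. coord x i \<in> \<int>}"

definition dual_lattice :: "'e set" where "dual_lattice = {x. \<forall>i<n. dual_coord x i \<in> \<int>}"

lemma lam_nz [simp]: "lam \<noteq> 0" using lam_pos by simp

lemma inner_dual_b: "\<lbrakk>i < n; j < n\<rbrakk> \<Longrightarrow> inner (dual i) (b j) = (if i = j then lam else 0)"
  unfolding dual_def using Z_gram by (simp add: inner_sum_left)

lemma coord_linear: "linear (\<lambda>x. coord x i)"
  by (rule linearI) (simp_all add: coord_def inner_add_right add_divide_distrib)

lemma dual_coord_linear: "linear (\<lambda>x. dual_coord x i)"
  by (rule linearI) (simp_all add: dual_coord_def inner_add_left add_divide_distrib)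

lemma coord_add [simp]: "coord (x + y) i = coord x i + coord y i"
  and coord_scaleR [simp]: "coord (c *\<^sub>R x) i = c * coord x i"
  and coord_zero [simp]: "coord 0 i = 0"
  and coord_minus [simp]: "coord (- x) i = - coord x i"
  and coord_diff [simp]: "coord (x - y) i = coord x i - coord y i"
  and coord_sum: "coord (sum f A) i = (\<Sum>k\<in>A. coord (f k) i)"
  by (simp_all add: coord_def inner_add_right inner_diff_right inner_sum_right add_divide_distrib
      diff_divide_distrib sum_divide_distrib)

lemma dual_coord_add [simp]: "dual_coord (x + y) i = dual_coord x i + dual_coord y i"
  and dual_coord_scaleR [simp]: "dual_coord (c *\<^sub>R x) i = c * dual_coord x i"
  and dual_coord_zero [simp]: "dual_coord 0 i = 0"
  and dual_coord_minus [simp]: "dual_coord (- x) i = - dual_coord x i"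
  and dual_coord_diff [simp]: "dual_coord (x - y) i = dual_coord x i - dual_coord y i"
  and dual_coord_sum: "dual_coord (sum f A) i = (\<Sum>k\<in>A. dual_coord (f k) i)"
  by (simp_all add: dual_coord_def inner_add_left inner_diff_left inner_sum_left add_divide_distrib
      diff_divide_distrib sum_divide_distrib)

lemma coord_b [simp]: "\<lbrakk>i < n; j < n\<rbrakk> \<Longrightarrow> coord (b j) i = (if i = j then 1 else 0)"
  by (simp add: coord_def inner_dual_b)

lemma dual_coord_dual [simp]: "\<lbrakk>i < n; j < n\<rbrakk> \<Longrightarrow> dual_coord (dual j) i = (if i = j then 1 else 0)"
  by (auto simp: dual_coord_def inner_dual_b)

lemma coord_combination [simp]: "i < n \<Longrightarrow> coord (\<Sum>j<n. c j *\<^sub>R b j) i = c i"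
  by (simp add: coord_sum if_distrib cong: if_cong)

lemma root_integer_combination:
  assumes "r \<in> R"
  shows "\<exists>c :: nat \<Rightarrow> int. r = (\<Sum>i<n. of_int (c i) *\<^sub>R b i)"
proof -
  obtain c :: "nat \<Rightarrow> int" where "r = (\<Sum>i=1..n. of_int (c i) *\<^sub>R \<alpha> i)"
    using basis assms unfolding root_basis_def by meson
  then have "r = (\<Sum>i<n. of_int (c (Suc i)) *\<^sub>R b i)"
    by (simp add: sum.atLeast1_atMost_eq)
  then show ?thesis by (rule exI[of _ "\<lambda>i. c (Suc i)"])
qed

text \<open>The identity holds on roots, which are combinations of simple roots, and the roots span.\<close>

lemma basis_expansion: "(\<Sum>i<n. coord x i *\<^sub>R b i) = x"
proof -
  have "x \<in> Real_Vector_Spaces.span R"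
    using root_system by (simp add: root_system_def)
  then show ?thesis
  proof (induction rule: span_induct_alt)
    case base
    then show ?case by simp
  next
    case (step c r y)
    obtain k :: "nat \<Rightarrow> int" where "r = (\<Sum>i<n. of_int (k i) *\<^sub>R b i)"
      using root_integer_combination step by blast
    then have "(\<Sum>i<n. coord r i *\<^sub>R b i) = r" by simp
    then show ?case
      using step by (simp add: scaleR_add_left sum.distrib flip: scaleR_scaleR scaleR_sum_right)
  qed
qed

lemma eq_if_coord_eq: "(\<And>i. i < n \<Longrightarrow> coord x i = coord y i) \<Longrightarrow> x = y"
  using basis_expansion[of x] basis_expansion[of y] by (metis (no_types, lifting) lessThan_iff sum.cong)

lemma inner_coord: "inner x y = lam * (\<Sum>i<n. coord x i * dual_coord y i)"
proof -
  have "inner x y = inner (\<Sum>i<n. coord x i *\<^sub>R b i) y" by (simp add: basis_expansion)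
  also have "\<dots> = lam * (\<Sum>i<n. coord x i * dual_coord y i)"
    by (simp add: inner_sum_left dual_coord_def sum_distrib_left inner_commute[of y])
  finally show ?thesis .
qed

lemma eq_if_dual_coord_eq:
  assumes "\<And>i. i < n \<Longrightarrow> dual_coord x i = dual_coord y i"
  shows "x = y"
proof -
  have "inner (x - y) (x - y) = 0"
    unfolding inner_coord[of "x - y"] using assms by simp
  then show ?thesis by simp
qed

lemma dual_expansion: "(\<Sum>i<n. dual_coord x i *\<^sub>R dual i) = x"
  by (rule eq_if_dual_coord_eq) (simp add: dual_coord_sum if_distrib cong: if_cong)

lemma root_lattice_closed:
  shows "0 \<in> root_lattice" "x \<in> root_lattice \<Longrightarrow> y \<in> root_lattice \<Longrightarrow> x + y \<in> root_lattice"
    "x \<in> root_lattice \<Longrightarrow> - x \<in> root_lattice"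
  by (simp_all add: root_lattice_def)

lemma dual_lattice_closed:
  shows "0 \<in> dual_lattice" "x \<in> dual_lattice \<Longrightarrow> y \<in> dual_lattice \<Longrightarrow> x + y \<in> dual_lattice"
    "x \<in> dual_lattice \<Longrightarrow> - x \<in> dual_lattice"
  by (simp_all add: dual_lattice_def)

lemma b_in_root_lattice: "i < n \<Longrightarrow> b i \<in> root_lattice"
  by (simp add: root_lattice_def)

lemma dual_in_dual_lattice: "i < n \<Longrightarrow> dual i \<in> dual_lattice"
  by (simp add: dual_lattice_def)

lemma int_combination_in_root_lattice: "(\<Sum>i<n. of_int (c i) *\<^sub>R b i) \<in> root_lattice"
  by (simp add: root_lattice_def)

lemma root_lattice_int_combination:
  assumes "x \<in> root_lattice"
  shows "\<exists>c :: nat \<Rightarrow> int. x = (\<Sum>i<n. of_int (c i) *\<^sub>R b i)"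
proof -
  have "x = (\<Sum>i<n. of_int \<lfloor>coord x i\<rfloor> *\<^sub>R b i)"
    using assms by (subst basis_expansion[symmetric]) (auto simp: root_lattice_def intro!: sum.cong)
  then show ?thesis by (rule exI[of _ "\<lambda>i. \<lfloor>coord x i\<rfloor>"])
qed

lemma dual_lattice_int_combination:
  assumes "x \<in> dual_lattice"
  shows "\<exists>c :: nat \<Rightarrow> int. x = (\<Sum>i<n. of_int (c i) *\<^sub>R dual i)"
proof -
  have "x = (\<Sum>i<n. of_int \<lfloor>dual_coord x i\<rfloor> *\<^sub>R dual i)"
    using assms by (subst dual_expansion[symmetric]) (auto simp: dual_lattice_def intro!: sum.cong)
  then show ?thesis by (rule exI[of _ "\<lambda>i. \<lfloor>dual_coord x i\<rfloor>"])
qed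

lemma basis_lattice_eq: "basis_lattice n \<alpha> = root_lattice"
proof
  show "basis_lattice n \<alpha> \<subseteq> root_lattice"
    unfolding basis_lattice_def One_nat_def sum.atLeast1_atMost_eq
    using int_combination_in_root_lattice[of "\<lambda>i. _ (Suc i)"] by auto
  show "root_lattice \<subseteq> basis_lattice n \<alpha>"
  proof
    fix x assume "x \<in> root_lattice"
    then obtain c :: "nat \<Rightarrow> int" where "x = (\<Sum>i<n. of_int (c i) *\<^sub>R b i)"
      using root_lattice_int_combination by blast
    then have "x = (\<Sum>i=1..n. of_int (c (i - 1)) *\<^sub>R \<alpha> i)"
      by (simp add: sum.atLeast1_atMost_eq)
    then show "x \<in> basis_lattice n \<alpha>"
      unfolding basis_lattice_def by (intro CollectI exI[of _ "\<lambda>i. c (i - 1)"]) simp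
  qed
qed

lemma pairing_integral:
  assumes "x \<in> root_lattice" "y \<in> dual_lattice"
  shows "inner x y / lam \<in> \<int>"
  using assms unfolding inner_coord by (auto simp: root_lattice_def dual_lattice_def intro!: Ints_sum Ints_mult)

lemma b_root: "i < n \<Longrightarrow> b i \<in> R"
  using basis unfolding root_basis_def by auto

lemma root_in_root_lattice: "r \<in> R \<Longrightarrow> r \<in> root_lattice"
  using root_integer_combination int_combination_in_root_lattice by metis

lemma b_nonzero: "i < n \<Longrightarrow> b i \<noteq> 0"
  using b_root root_system unfolding root_system_def by metis

abbreviation W where "W \<equiv> weyl_group R"

lemma
  assumes "g \<in> carrier W"
  shows weyl_linear: "linear g" and weyl_inner: "inner (g x) (g y) = inner x y"
    and weyl_roots: "g ` R = R" and weyl_bij: "bij g"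
  using weyl_group_properties[OF root_system assms] by auto

lemma weyl_mult: "g \<in> carrier W \<Longrightarrow> h \<in> carrier W \<Longrightarrow> g \<otimes>\<^bsub>W\<^esub> h = g \<circ> h"
  by (rule weyl_group_mult[OF root_system])

lemma reflection_in_weyl: "i < n \<Longrightarrow> reflection (b i) \<in> carrier W"
  using b_root by (auto simp: weyl_group_def intro: generate.incl)

lemma root_lattice_sum: "(\<And>i. i \<in> A \<Longrightarrow> f i \<in> root_lattice) \<Longrightarrow> (\<Sum>i\<in>A. of_int (c i) *\<^sub>R f i) \<in> root_lattice"
  by (auto simp: root_lattice_def coord_sum intro!: Ints_sum)

text \<open>An element of the Weyl group permutes the roots. Hence it maps the root lattice into itself, and
  onto it because each simple root is the image of a root.\<close>

lemma weyl_root_lattice: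
  assumes g: "g \<in> carrier W"
  shows "g ` root_lattice = root_lattice"
proof
  show "g ` root_lattice \<subseteq> root_lattice"
  proof clarify
    fix x assume "x \<in> root_lattice"
    then obtain c :: "nat \<Rightarrow> int" where "x = (\<Sum>i<n. of_int (c i) *\<^sub>R b i)"
      using root_lattice_int_combination by blast
    then have "g x = (\<Sum>i<n. of_int (c i) *\<^sub>R g (b i))"
      using weyl_linear[OF g] by (simp add: linear_sum linear_scale)
    also have "\<dots> \<in> root_lattice"
      by (rule root_lattice_sum) (use weyl_roots[OF g] b_root root_in_root_lattice in auto)
    finally show "g x \<in> root_lattice" .
  qed
  show "root_lattice \<subseteq> g ` root_lattice"
  proof
    fix x assume "x \<in> root_lattice"
    then obtain c :: "nat \<Rightarrow> int" where c: "x = (\<Sum>i<n. of_int (c i) *\<^sub>R b i)"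
      using root_lattice_int_combination by blast
    have "\<forall>i<n. \<exists>r. r \<in> R \<and> g r = b i"
      using weyl_roots[OF g] b_root by (metis imageE)
    then obtain r where r: "\<And>i. i < n \<Longrightarrow> r i \<in> R \<and> g (r i) = b i" by metis
    have "g (\<Sum>i<n. of_int (c i) *\<^sub>R r i) = x"
      using weyl_linear[OF g] r c by (simp add: linear_sum linear_scale)
    moreover have "(\<Sum>i<n. of_int (c i) *\<^sub>R r i) \<in> root_lattice"
      by (rule root_lattice_sum) (use r root_in_root_lattice in auto)
    ultimately show "x \<in> g ` root_lattice" by blast
  qed
qed

lemma dual_lattice_iff: "y \<in> dual_lattice \<longleftrightarrow> (\<forall>x\<in>root_lattice. inner x y / lam \<in> \<int>)"
  using pairing_integral b_in_root_lattice
  by (auto simp: dual_lattice_def dual_coord_def inner_commute) 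

text \<open>The dual lattice is described by its pairing with the root lattice, and the Weyl group
  preserves both this pairing and the root lattice.\<close>

lemma weyl_dual_lattice:
  assumes g: "g \<in> carrier W"
  shows "g ` dual_lattice = dual_lattice"
proof -
  have iff: "g y \<in> dual_lattice \<longleftrightarrow> y \<in> dual_lattice" for y
  proof -
    have "g y \<in> dual_lattice \<longleftrightarrow> (\<forall>x\<in>g ` root_lattice. inner x (g y) / lam \<in> \<int>)"
      by (simp add: dual_lattice_iff weyl_root_lattice[OF g])
    then show ?thesis by (simp add: dual_lattice_iff weyl_inner[OF g])
  qed
  show ?thesis
  proof
    show "g ` dual_lattice \<subseteq> dual_lattice" using iff by blast
    show "dual_lattice \<subseteq> g ` dual_lattice"
      using iff bij_is_surj[OF weyl_bij[OF g]] by (metis image_iff subsetI surjD)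
  qed
qed

lemma root_lattice_additive:
  fixes f :: "'e \<Rightarrow> 'b::real_vector"
  assumes "\<And>x y. x \<in> root_lattice \<Longrightarrow> y \<in> root_lattice \<Longrightarrow> f (x + y) = f x + f y" "m \<in> root_lattice"
  shows "f m = (\<Sum>i<n. coord m i *\<^sub>R f (b i))"
proof -
  obtain c :: "nat \<Rightarrow> int" where c: "m = (\<Sum>i<n. of_int (c i) *\<^sub>R b i)"
    using root_lattice_int_combination assms by blast
  show ?thesis unfolding c
    using additive_int_combination[of root_lattice f n b c] root_lattice_closed b_in_root_lattice assms(1)
    by simp
qed

lemma dual_lattice_additive:
  fixes f :: "'e \<Rightarrow> 'b::real_vector"
  assumes "\<And>x y. x \<in> dual_lattice \<Longrightarrow> y \<in> dual_lattice \<Longrightarrow> f (x + y) = f x + f y" "p \<in> dual_lattice"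
  shows "f p = (\<Sum>i<n. dual_coord p i *\<^sub>R f (dual i))"
proof -
  obtain c :: "nat \<Rightarrow> int" where c: "p = (\<Sum>i<n. of_int (c i) *\<^sub>R dual i)"
    using dual_lattice_int_combination assms by blast
  have "dual_coord p i = c i" if "i < n" for i
    using that by (simp add: c dual_coord_sum if_distrib cong: if_cong)
  then show ?thesis 
    using additive_int_combination[of dual_lattice f n dual c] dual_lattice_closed dual_in_dual_lattice assms(1) c
    by simp
qed

lemma linear_b_expansion:
  fixes f :: "'e \<Rightarrow> 'b::real_vector"
  shows "linear f \<Longrightarrow> f x = (\<Sum>i<n. coord x i *\<^sub>R f (b i))"
  by (subst basis_expansion[of x, symmetric]) (simp add: linear_sum linear_scale del: coord_combination)

lemma linear_dual_expansion:
  fixes f :: "'e \<Rightarrow> 'b::real_vector"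
  shows "linear f \<Longrightarrow> f x = (\<Sum>i<n. dual_coord x i *\<^sub>R f (dual i))"
  by (subst dual_expansion[of x, symmetric]) (simp add: linear_sum linear_scale)

end

section \<open>From the Cartan matrix to the Gram matrix\<close>

text \<open>Write \<open>A\<close> for the Cartan matrix, \<open>D\<close> for the diagonal matrix \<open>Z\<^sub>0 A\<close> with entries \<open>d i\<close>, and
  \<open>l i\<close> for the squared length of the \<open>i\<close>-th simple root. Symmetry of \<open>A\<^sup>T Z\<^sub>0 A\<close> gives
  \<open>d i * a i j = d j * a j i\<close>, and symmetry of the Gram matrix gives \<open>l j * a i j = l i * a j i\<close>.
  Hence \<open>d i * l i = d j * l j\<close> whenever \<open>a i j\<close> is nonzero, and this product is constant because
  the diagram is connected. Half of the constant is the scalar \<open>lam\<close>.\<close>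

lemma bourbaki_basis_root_frame:
  assumes R: "root_system R" and B: "bourbaki_basis T R \<alpha>"
  shows "\<exists>lam. root_frame R (type_rank T) \<alpha> (Z0 T) lam"
proof -
  let ?n = "type_rank T" and ?b = "\<lambda>i. \<alpha> (Suc i)" and ?Z = "Z0 T"
  define a where "a i j = real_of_int (cartan_integer T (Suc i) (Suc j))" for i j
  have valid: "valid_type T" and basis: "root_basis R ?n \<alpha>" using B by (auto simp: bourbaki_basis_def)
  have n: "0 < ?n" using valid by (cases T) auto
  have bR: "?b i \<in> R" if "i < ?n" for i using that basis unfolding root_basis_def by auto
  have sq: "inner (?b i) (?b i) > 0" if "i < ?n" for i
    using bR[OF that] R unfolding root_system_def by (metis inner_gt_zero_iff)
  have a: "2 * inner (?b i) (?b j) = a i j * inner (?b j) (?b j)" if "i < ?n" "j < ?n" for i j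
  proof -
    have "2 * inner (?b i) (?b j) / inner (?b j) (?b j) = a i j"
      using B that by (simp add: bourbaki_basis_def a_def del: cartan_integer.simps)
    then show ?thesis using sq[OF that(2)] by (simp add: field_simps)
  qed
  obtain d where d: "\<And>j. j < ?n \<Longrightarrow> 0 < d j"
    and Za: "\<And>i j. \<lbrakk>i < ?n; j < ?n\<rbrakk> \<Longrightarrow> (\<Sum>k<?n. ?Z $$ (i, k) * a k j) = (if i = j then d j else 0)"
    using Z0_diagonalizes_cartan_matrix[OF valid] unfolding diagonalizes_def a_def by blast
  have sym: "a j i * d j = d i * a i j" if ij: "i < ?n" "j < ?n" for i j
  proof -
    have "(\<Sum>k<?n. a k i * (\<Sum>l<?n. ?Z $$ (k, l) * a l j)) = a j i * d j"
      using ij by (simp add: Za if_distrib cong: if_cong)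
    moreover have "(\<Sum>k<?n. a k i * (\<Sum>l<?n. ?Z $$ (k, l) * a l j)) = (\<Sum>l<?n. (\<Sum>k<?n. ?Z $$ (l, k) * a k i) * a l j)"
      unfolding sum_distrib_left sum_distrib_right
      by (subst sum.swap) (intro sum.cong refl, simp add: Z0_symmetric del: Z0.simps)
    moreover have "(\<Sum>l<?n. (\<Sum>k<?n. ?Z $$ (l, k) * a k i) * a l j) = d i * a i j"
      using ij by (simp add: Za if_distribR if_distrib[of "\<lambda>x. x * _"] cong: if_cong)
    ultimately show ?thesis by simp
  qed
  define c where "c i = d i * inner (?b i) (?b i)" for i
  have c: "c i = c 0" if i: "i < ?n" for i
  proof (rule dynkin_diagram_connected[OF valid, of "\<lambda>i. c i = c 0", OF _ _ i])
    fix i j assume ij: "i < ?n" "j < ?n" and "cartan_integer T (Suc i) (Suc j) \<noteq> 0" and ci: "c i = c 0"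
    then have nz: "a i j \<noteq> 0" by (simp add: a_def)
    have "a i j * inner (?b j) (?b j) = a j i * inner (?b i) (?b i)"
      using a[OF ij] a[OF ij(2) ij(1)] by (simp add: inner_commute)
    then have "a i j * c j = d j * a j i * inner (?b i) (?b i)" by (simp add: c_def)
    also have "\<dots> = a i j * c i" using sym[OF ij] by (simp add: c_def ac_simps)
    finally show "c j = c 0" using nz ci by simp
  qed simp
  show ?thesis
  proof (rule exI[of _ "c 0 / 2"], unfold_locales)
    show "root_system R" "root_basis R ?n \<alpha>" "0 < ?n" by fact+
    show "?Z \<in> carrier_mat ?n ?n" by (rule Z0_carrier)
    show "0 < c 0 / 2" using d[OF n] sq[OF n] by (simp add: c_def)
    fix i j assume ij: "i < ?n" "j < ?n"
    show "?Z $$ (i, j) = ?Z $$ (j, i)" using ij by (rule Z0_symmetric)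
    have "inner (?b k) (?b j) = a k j * (inner (?b j) (?b j) / 2)" if "k < ?n" for k
      using a[OF that ij(2)] by simp
    then have "(\<Sum>k<?n. ?Z $$ (i, k) * inner (?b k) (?b j)) = (\<Sum>k<?n. ?Z $$ (i, k) * a k j) * (inner (?b j) (?b j) / 2)"
      unfolding sum_distrib_right by (intro sum.cong refl) simp
    also have "\<dots> = (if i = j then c 0 / 2 else 0)"
      using ij c[OF ij(2)] by (simp add: Za c_def)
    finally show "(\<Sum>k<?n. ?Z $$ (i, k) * inner (?b k) (?b j)) = (if i = j then c 0 / 2 else 0)" .
  next
    fix P i assume P: "P 0" "\<And>i j. \<lbrakk>i < ?n; j < ?n; inner (?b i) (?b j) \<noteq> 0; P i\<rbrakk> \<Longrightarrow> P j" and i: "i < ?n"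
    show "P i"
    proof (rule dynkin_diagram_connected[OF valid, of P, OF P(1) _ i])
      fix i j assume ij: "i < ?n" "j < ?n" and nz: "cartan_integer T (Suc i) (Suc j) \<noteq> 0" and "P i"
      have "inner (?b i) (?b j) \<noteq> 0" using a[OF ij] sq[OF ij(2)] nz by (auto simp: a_def)
      then show "P j" using P(2) ij \<open>P i\<close> by blast
    qed
  qed
qed

section \<open>The abelian varieties with Riemann matrix \<open>\<tau> Z\<^sub>0\<close>\<close>

context root_frame
begin

text \<open>The identification of \<open>\<complex>\<^sup>n\<close> with the complexification of the Euclidean space: \<open>cvec x y\<close>
  corresponds to \<open>x + \<i> y\<close>.\<close>

definition re_part :: "complex vec \<Rightarrow> 'e" where "re_part v = (\<Sum>i<n. Re (v $ i) *\<^sub>R b i)"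

definition im_part :: "complex vec \<Rightarrow> 'e" where "im_part v = (\<Sum>i<n. Im (v $ i) *\<^sub>R b i)"

definition cvec :: "'e \<Rightarrow> 'e \<Rightarrow> complex vec" where
  "cvec x y = vec n (\<lambda>i. Complex (coord x i) (coord y i))"

lemma cvec_carrier [simp]: "cvec x y \<in> carrier_vec n"
  by (simp add: cvec_def)

lemma dim_cvec [simp]: "dim_vec (cvec x y) = n"
  by (simp add: cvec_def)

lemma cvec_index: "i < n \<Longrightarrow> cvec x y $ i = Complex (coord x i) (coord y i)"
  by (simp add: cvec_def)

lemma re_part_cvec [simp]: "re_part (cvec x y) = x"
  by (simp add: re_part_def cvec_def basis_expansion)

lemma im_part_cvec [simp]: "im_part (cvec x y) = y"
  by (simp add: im_part_def cvec_def basis_expansion)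

lemma cvec_parts [simp]: "v \<in> carrier_vec n \<Longrightarrow> cvec (re_part v) (im_part v) = v"
  by (intro eq_vecI) (simp_all add: cvec_def re_part_def im_part_def complex_eq_iff)

lemma cvec_cases: 
  assumes "v \<in> carrier_vec n"
  obtains x y where "v = cvec x y"
  using cvec_parts[OF assms] by metis

lemma cvec_eq_iff [simp]: "cvec x y = cvec x' y' \<longleftrightarrow> x = x' \<and> y = y'"
  by (metis re_part_cvec im_part_cvec)

lemma cvec_add [simp]: "cvec x y + cvec x' y' = cvec (x + x') (y + y')"
  by (intro eq_vecI) (simp_all add: cvec_index complex_eq_iff)

lemma cvec_smult [simp]:
  "c \<cdot>\<^sub>v cvec x y = cvec (Re c *\<^sub>R x - Im c *\<^sub>R y) (Re c *\<^sub>R y + Im c *\<^sub>R x)"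
  by (intro eq_vecI) (simp_all add: cvec_index complex_eq_iff)

lemma cvec_zero: "0\<^sub>v n = cvec 0 0"
  by (intro eq_vecI) (simp_all add: cvec_index complex_eq_iff)

definition gram_form :: "complex vec \<Rightarrow> complex vec \<Rightarrow> complex" where
  "gram_form v w = (\<Sum>i<n. \<Sum>j<n. of_real (inner (b i) (b j)) * (cnj (v $ i) * w $ j))"

lemma inner_combinations:
  "inner (\<Sum>i<n. x i *\<^sub>R b i) (\<Sum>j<n. y j *\<^sub>R b j) = (\<Sum>i<n. \<Sum>j<n. inner (b i) (b j) * (x i * y j))"
  unfolding inner_sum_left by (rule sum.cong[OF refl]) (simp add: inner_sum_right sum_distrib_left ac_simps)

text \<open>The sesquilinear form given by the Gram matrix is the Hermitian extension of the inner
  product.\<close>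

lemma gram_form_eq:
  "gram_form v w = Complex (inner (re_part v) (re_part w) + inner (im_part v) (im_part w))
     (inner (re_part v) (im_part w) - inner (im_part v) (re_part w))"
proof (rule complex_eqI)
  have "Re (gram_form v w) = (\<Sum>i<n. \<Sum>j<n. inner (b i) (b j) * (Re (v $ i) * Re (w $ j))
      + inner (b i) (b j) * (Im (v $ i) * Im (w $ j)))"
    unfolding gram_form_def Re_sum by (intro sum.cong refl) (simp add: distrib_left)
  then show "Re (gram_form v w) = Re (Complex (inner (re_part v) (re_part w) + inner (im_part v) (im_part w))
     (inner (re_part v) (im_part w) - inner (im_part v) (re_part w)))"
    by (simp add: re_part_def im_part_def inner_combinations sum.distrib)
  have "Im (gram_form v w) = (\<Sum>i<n. \<Sum>j<n. inner (b i) (b j) * (Re (v $ i) * Im (w $ j))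
      - inner (b i) (b j) * (Im (v $ i) * Re (w $ j)))"
    unfolding gram_form_def Im_sum by (intro sum.cong refl) (simp add: right_diff_distrib)
  then show "Im (gram_form v w) = Im (Complex (inner (re_part v) (re_part w) + inner (im_part v) (im_part w))
     (inner (re_part v) (im_part w) - inner (im_part v) (re_part w)))"
    by (simp add: re_part_def im_part_def inner_combinations sum_subtractf)
qed

end

locale riemann_frame = root_frame R n \<alpha> Z lam
  for R :: "'e::euclidean_space set" and n \<alpha> Z lam +
  fixes \<tau> :: complex
  assumes Im_tau_gt0: "0 < Im \<tau>"
begin

definition Zt :: "complex mat" where "Zt = \<tau> \<cdot>\<^sub>m map_mat complex_of_real Z"

abbreviation X where "X \<equiv> riemann_ppav n Zt"

lemma Im_Zt: "map_mat Im Zt = Im \<tau> \<cdot>\<^sub>m Z"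
  by (intro eq_matI) (simp_all add: Zt_def)

text \<open>The inverse of the imaginary part of \<open>\<tau> Z\<close> is a multiple of the Gram matrix.\<close>

definition G :: "real mat" where "G = mat n n (\<lambda>(i, j). inner (b i) (b j) / (lam * Im \<tau>))"

lemma tangent_X [simp]: "tangent X = module_vec TYPE(complex) n"
  by (simp add: riemann_ppav_def)

lemma inverse_Im_Zt: "mat_inverse (Im \<tau> \<cdot>\<^sub>m Z) = Some G"
proof -
  let ?A = "Im \<tau> \<cdot>\<^sub>m Z"
  have A: "?A \<in> carrier_mat n n" and G: "G \<in> carrier_mat n n"
    using Z_carrier by (simp_all add: G_def)
  have AG: "?A * G = 1\<^sub>m n"
  proof (rule eq_matI)
    fix i j assume "i < dim_row (1\<^sub>m n :: real mat)" "j < dim_col (1\<^sub>m n :: real mat)"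
    then have ij: "i < n" "j < n" by auto
    have "(?A * G) $$ (i, j) = (\<Sum>k<n. Im \<tau> * Z $$ (i, k) * (inner (b k) (b j) / (lam * Im \<tau>)))"
      using ij Z_carrier A G by (simp add: scalar_prod_def G_def lessThan_atLeast0)
    also have "\<dots> = (\<Sum>k<n. Z $$ (i, k) * inner (b k) (b j)) / lam"
      using Im_tau_gt0 by (simp add: sum_divide_distrib)
    also have "\<dots> = 1\<^sub>m n $$ (i, j)"
      using ij by (simp add: Z_gram)
    finally show "(?A * G) $$ (i, j) = 1\<^sub>m n $$ (i, j)" .
  qed (use A G in auto)
  then have GA: "G * ?A = 1\<^sub>m n"
    using mat_mult_left_right_inverse A G by blast
  show ?thesis
  proof (cases "mat_inverse ?A")
    case None
    from mat_inverse(1)[OF A None, of "()"] A G AG GA show ?thesis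
      by (auto simp: Units_def ring_mat_def)
  next
    case (Some B)
    from mat_inverse(2)[OF A Some] have B: "B * ?A = 1\<^sub>m n" "B \<in> carrier_mat n n" by auto
    have "B = B * (?A * G)" using B AG by simp
    also have "\<dots> = G" using B A G by (simp flip: assoc_mult_mat)
    finally show ?thesis using Some by simp
  qed
qed

lemma herm_X:
  assumes "v \<in> carrier_vec n" "w \<in> carrier_vec n"
  shows "herm X v w = gram_form v w / of_real (lam * Im \<tau>)"
proof -
  have "herm X v w = (\<Sum>i<n. (\<Sum>j<n. of_real (inner (b i) (b j) / (lam * Im \<tau>)) * w $ j) * cnj (v $ i))"
    using assms
    by (simp add: riemann_ppav_def Im_Zt inverse_Im_Zt scalar_prod_def G_def lessThan_atLeast0)
  also have "\<dots> = gram_form v w / of_real (lam * Im \<tau>)"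
    unfolding gram_form_def sum_divide_distrib sum_distrib_right
    by (intro sum.cong refl) simp
  finally show ?thesis .
qed

lemma herm_cvec:
  "herm X (cvec x y) (cvec x' y') =
     Complex (inner x x' + inner y y') (inner x y' - inner y x') / of_real (lam * Im \<tau>)"
  by (simp add: herm_X gram_form_eq)

text \<open>The vector \<open>m + \<tau> p\<close>. Since \<open>\<tau>\<close> is not real, the pair \<open>(m, p)\<close> is a second system of
  coordinates on \<open>\<complex>\<^sup>n\<close>, adapted to the lattice and to the symplectic form.\<close>

definition lat :: "'e \<Rightarrow> 'e \<Rightarrow> complex vec" where
  "lat m p = cvec (m + Re \<tau> *\<^sub>R p) (Im \<tau> *\<^sub>R p)"

lemma lat_carrier [simp]: "lat m p \<in> carrier_vec n"
  by (simp add: lat_def)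

lemma lat_add [simp]: "lat m p + lat m' p' = lat (m + m') (p + p')"
  by (simp add: lat_def algebra_simps)

lemma lat_zero: "0\<^sub>v n = lat 0 0"
  by (simp add: lat_def cvec_zero)

lemma lat_scale [simp]: "complex_of_real c \<cdot>\<^sub>v lat m p = lat (c *\<^sub>R m) (c *\<^sub>R p)"
  by (simp add: lat_def algebra_simps)

lemma lat_eq_iff [simp]: "lat m p = lat m' p' \<longleftrightarrow> m = m' \<and> p = p'"
  using Im_tau_gt0 by (auto simp: lat_def)

lemma lat_cases:
  assumes "v \<in> carrier_vec n"
  obtains m p where "v = lat m p"
proof -
  obtain x y where "v = cvec x y" using assms by (rule cvec_cases)
  then have "v = lat (x - (Re \<tau> / Im \<tau>) *\<^sub>R y) ((1 / Im \<tau>) *\<^sub>R y)"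
    using Im_tau_gt0 by (simp add: lat_def)
  then show thesis by (rule that)
qed

lemma Im_herm_lat: "Im (herm X (lat m p) (lat m' p')) = (inner m p' - inner p m') / lam"
  using Im_tau_gt0 by (simp add: lat_def herm_cvec inner_add_left inner_add_right field_simps inner_commute)

lemma Zt_mult_vec:
  assumes "c \<in> carrier_vec n"
  shows "Zt *\<^sub>v map_vec complex_of_int c = lat 0 (\<Sum>j<n. of_int (c $ j) *\<^sub>R dual j)"
proof (rule eq_vecI)
  have coord_dual: "coord (dual j) i = Z $$ (i, j)" if "i < n" "j < n" for i j
    using that by (simp add: dual_def Z_symmetric)
  fix i assume "i < dim_vec (lat 0 (\<Sum>j<n. of_int (c $ j) *\<^sub>R dual j))"
  then have i: "i < n" by (simp add: lat_def)
  have "(Zt *\<^sub>v map_vec complex_of_int c) $ i = (\<Sum>j<n. \<tau> * of_real (Z $$ (i, j)) * of_int (c $ j))"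
    using i assms Z_carrier by (simp add: Zt_def scalar_prod_def lessThan_atLeast0)
  also have "\<dots> = lat 0 (\<Sum>j<n. of_int (c $ j) *\<^sub>R dual j) $ i"
    using i by (simp add: lat_def cvec_index complex_eq_iff coord_sum coord_dual sum_distrib_left algebra_simps)
  finally show "(Zt *\<^sub>v map_vec complex_of_int c) $ i = lat 0 (\<Sum>j<n. of_int (c $ j) *\<^sub>R dual j) $ i" .
qed (use Z_carrier in \<open>simp add: lat_def Zt_def\<close>)

lemma int_vec_lat:
  assumes "a \<in> carrier_vec n"
  shows "map_vec complex_of_int a = lat (\<Sum>j<n. of_int (a $ j) *\<^sub>R b j) 0"
  using assms by (intro eq_vecI) (simp_all add: lat_def cvec_index complex_eq_iff)

lemma lattice_X: "lattice X = {lat m p | m p. m \<in> root_lattice \<and> p \<in> dual_lattice}" (is "_ = ?L")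
proof
  have "map_vec complex_of_int a + Zt *\<^sub>v map_vec complex_of_int c \<in> ?L"
    if "a \<in> carrier_vec n" "c \<in> carrier_vec n" for a c
    unfolding Zt_mult_vec[OF that(2)] int_vec_lat[OF that(1)]
    by (auto simp: root_lattice_def dual_lattice_def dual_coord_sum if_distrib cong: if_cong)
  then show "lattice X \<subseteq> ?L" by (auto simp: riemann_ppav_def)
  show "?L \<subseteq> lattice X"
  proof clarify
    fix m p assume "m \<in> root_lattice" "p \<in> dual_lattice"
    then obtain c d :: "nat \<Rightarrow> int"
      where c: "m = (\<Sum>i<n. of_int (c i) *\<^sub>R b i)" and d: "p = (\<Sum>i<n. of_int (d i) *\<^sub>R dual i)"
      using root_lattice_int_combination dual_lattice_int_combination by metis
    have "map_vec complex_of_int (vec n c) = lat m 0"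
      by (subst int_vec_lat) (simp_all add: c)
    moreover have "Zt *\<^sub>v map_vec complex_of_int (vec n d) = lat 0 p"
      by (subst Zt_mult_vec) (simp_all add: d)
    ultimately have "lat m p = map_vec complex_of_int (vec n c) + Zt *\<^sub>v map_vec complex_of_int (vec n d)"
      by (simp only: lat_add) simp
    then show "lat m p \<in> lattice X"
      unfolding riemann_ppav_def polarized_torus.select_convs mem_Collect_eq
      using vec_carrier by blast
  qed
qed

lemma finsum_lat:
  assumes "finite A"
  shows "finsum (module_vec TYPE(complex) n) (\<lambda>i. lat (f i) (g i)) A = lat (sum f A) (sum g A)"
proof -
  interpret vec_space "TYPE(complex)" n .
  show ?thesis using assms
    by (induction A rule: finite_induct) (simp_all add: finsum_insert Pi_def lat_zero)
qed

definition period :: "nat \<Rightarrow> complex vec" where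
  "period i = (if i < n then lat (b i) 0 else lat 0 (dual (i - n)))"

lemma sum_double: "(\<Sum>i<2 * n. h i) = (\<Sum>i<n. h i) + (\<Sum>i<n. h (n + i))"
  for h :: "nat \<Rightarrow> 'a::comm_monoid_add"
proof -
  have "(\<Sum>i<n + k. h i) = (\<Sum>i<n. h i) + (\<Sum>i<k. h (n + i))" for k
    by (induction k) (simp_all add: add.assoc)
  from this[of n] show ?thesis by (simp add: mult_2)
qed

lemma period_combination:
  "(\<Oplus>\<^bsub>module_vec TYPE(complex) n\<^esub>i\<in>{..<2 * n}. complex_of_real (x i) \<odot>\<^bsub>module_vec TYPE(complex) n\<^esub> period i)
    = lat (\<Sum>i<n. x i *\<^sub>R b i) (\<Sum>i<n. x (n + i) *\<^sub>R dual i)"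
proof -
  have "complex_of_real (x i) \<cdot>\<^sub>v period i
      = lat (if i < n then x i *\<^sub>R b i else 0) (if i < n then 0 else x i *\<^sub>R dual (i - n))" for i
    by (simp add: period_def)
  then show ?thesis
    by (simp add: module_vec_def finsum_lat[unfolded module_vec_def] sum_double)
qed

lemma real_basis_period: "real_basis (module_vec TYPE(complex) n) (2 * n) period"
  unfolding real_basis_def period_combination
proof (intro conjI ballI)
  show "period \<in> {..<2 * n} \<rightarrow> carrier (module_vec TYPE(complex) n)"
    by (simp add: period_def module_vec_simps)
  fix v assume "v \<in> carrier (module_vec TYPE(complex) n)"
  then obtain m p where v: "v = lat m p" by (auto simp: module_vec_simps elim: lat_cases)
  define x where "x = restrict (\<lambda>i. if i < n then coord m i else dual_coord p (i - n)) {..<2 * n}"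
  show "\<exists>!x. x \<in> extensional {..<2 * n} \<and> v = lat (\<Sum>i<n. x i *\<^sub>R b i) (\<Sum>i<n. x (n + i) *\<^sub>R dual i)"
  proof (rule ex1I[of _ x])
    show "x \<in> extensional {..<2 * n} \<and> v = lat (\<Sum>i<n. x i *\<^sub>R b i) (\<Sum>i<n. x (n + i) *\<^sub>R dual i)"
      by (simp add: v x_def basis_expansion dual_expansion)
    fix y :: "nat \<Rightarrow> real"
    assume y: "y \<in> extensional {..<2 * n} \<and> v = lat (\<Sum>i<n. y i *\<^sub>R b i) (\<Sum>i<n. y (n + i) *\<^sub>R dual i)"
    then have "m = (\<Sum>i<n. y i *\<^sub>R b i)" "p = (\<Sum>i<n. y (n + i) *\<^sub>R dual i)" by (auto simp: v)
    then have c: "coord m i = y i" "dual_coord p i = y (n + i)" if "i < n" for i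
      using that by (simp_all add: dual_coord_sum if_distrib cong: if_cong)
    show "y = x"
    proof
      fix i show "y i = x i"
        using y c(1)[of i] c(2)[of "i - n"] by (auto simp: x_def extensional_def)
    qed
  qed
qed

lemma full_lattice_X: "full_lattice (module_vec TYPE(complex) n) n (lattice X)"
  unfolding full_lattice_def
proof (intro exI[of _ period] conjI real_basis_period)
  have "(\<Oplus>\<^bsub>module_vec TYPE(complex) n\<^esub>i\<in>{..<2 * n}. complex_of_int (k i) \<odot>\<^bsub>module_vec TYPE(complex) n\<^esub> period i)
    = lat (\<Sum>i<n. of_int (k i) *\<^sub>R b i) (\<Sum>i<n. of_int (k (n + i)) *\<^sub>R dual i)" for k :: "nat \<Rightarrow> int"
    using period_combination[of "\<lambda>i. of_int (k i)"] by simp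
  then have "{\<Oplus>\<^bsub>module_vec TYPE(complex) n\<^esub>i\<in>{..<2 * n}. complex_of_int (k i) \<odot>\<^bsub>module_vec TYPE(complex) n\<^esub> period i
     | k :: nat \<Rightarrow> int. True} = {lat (\<Sum>i<n. of_int (k i) *\<^sub>R b i) (\<Sum>i<n. of_int (k (n + i)) *\<^sub>R dual i) | k :: nat \<Rightarrow> int. True}"
    by simp
  also have "\<dots> = lattice X"
  proof
    have "(\<Sum>i<n. of_int (k i) *\<^sub>R b i) \<in> root_lattice"
        "(\<Sum>i<n. of_int (k (n + i)) *\<^sub>R dual i) \<in> dual_lattice" for k :: "nat \<Rightarrow> int"
      by (auto simp: root_lattice_def dual_lattice_def dual_coord_sum if_distrib cong: if_cong)
    then show "{lat (\<Sum>i<n. of_int (k i) *\<^sub>R b i) (\<Sum>i<n. of_int (k (n + i)) *\<^sub>R dual i) | k :: nat \<Rightarrow> int. True}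
        \<subseteq> lattice X"
      unfolding lattice_X by blast
    show "lattice X \<subseteq>
        {lat (\<Sum>i<n. of_int (k i) *\<^sub>R b i) (\<Sum>i<n. of_int (k (n + i)) *\<^sub>R dual i) | k :: nat \<Rightarrow> int. True}"
      unfolding lattice_X
    proof clarify
      fix m p assume "m \<in> root_lattice" "p \<in> dual_lattice"
      then obtain c d :: "nat \<Rightarrow> int"
        where c: "m = (\<Sum>i<n. of_int (c i) *\<^sub>R b i)" and d: "p = (\<Sum>i<n. of_int (d i) *\<^sub>R dual i)"
        using root_lattice_int_combination dual_lattice_int_combination by metis
      show "\<exists>k :: nat \<Rightarrow> int. lat m p
          = lat (\<Sum>i<n. of_int (k i) *\<^sub>R b i) (\<Sum>i<n. of_int (k (n + i)) *\<^sub>R dual i) \<and> True"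
        by (rule exI[of _ "\<lambda>i. if i < n then c i else d (i - n)"]) (simp add: c d)
    qed
  qed
  finally show "lattice X = {\<Oplus>\<^bsub>module_vec TYPE(complex) n\<^esub>i\<in>{..<2 * n}. complex_of_int (k i) \<odot>\<^bsub>module_vec TYPE(complex) n\<^esub> period i
     | k :: nat \<Rightarrow> int. True}" by simp
qed

lemma hermitian_form_X: "hermitian_form (module_vec TYPE(complex) n) (herm X)"
  unfolding hermitian_form_def module_vec_simps
proof (intro conjI ballI allI)
  fix u v w :: "complex vec" and c
  assume u: "u \<in> carrier_vec n" and v: "v \<in> carrier_vec n"
  from u obtain x y where xy: "u = cvec x y" by (rule cvec_cases)
  from v obtain x' y' where x'y': "v = cvec x' y'" by (rule cvec_cases)
  show "herm X v u = cnj (herm X u v)"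
    by (simp add: xy x'y' herm_cvec inner_commute complex_eq_iff)
  show "herm X u (c \<cdot>\<^sub>v v) = c * herm X u v"
    by (simp add: xy x'y' herm_cvec inner_diff_right inner_add_right complex_eq_iff field_simps)
  assume "w \<in> carrier_vec n"
  then obtain x'' y'' where "w = cvec x'' y''" by (rule cvec_cases)
  then show "herm X u (v + w) = herm X u v + herm X u w"
    by (simp add: xy x'y' herm_cvec inner_add_right complex_eq_iff add_divide_distrib[symmetric])
qed

lemma positive_definite_X: "positive_definite (module_vec TYPE(complex) n) (herm X)"
  unfolding positive_definite_def module_vec_simps
proof (intro ballI impI)
  fix v :: "complex vec" assume "v \<in> carrier_vec n" and nz: "v \<noteq> 0\<^sub>v n"
  then obtain x y where v: "v = cvec x y" by (meson cvec_cases)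
  with nz have "x \<noteq> 0 \<or> y \<noteq> 0" by (auto simp: cvec_zero)
  then have "inner x x + inner y y > 0"
    by (metis add_nonneg_pos add_pos_nonneg inner_ge_zero inner_gt_zero_iff)
  then show "Re (herm X v v) > 0"
    using lam_pos Im_tau_gt0 by (simp add: v herm_cvec)
qed

text \<open>An additive function on the lattice is determined by its values on the simple roots and on the
  dual basis; the coefficients of the vector representing it are these values, exchanged between
  the two bases and with a sign for one of them.\<close>

lemma unimodular_X: "unimodular_on (module_vec TYPE(complex) n) (lattice X) (\<lambda>x y. Im (herm X x y))"
  unfolding unimodular_on_def module_vec_simps
proof (intro allI impI)
  fix \<phi> :: "complex vec \<Rightarrow> int"
  assume add: "\<forall>x\<in>lattice X. \<forall>y\<in>lattice X. \<phi> (x + y) = \<phi> x + \<phi> y"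
  define f where "f m = real_of_int (\<phi> (lat m 0))" for m
  define g where "g p = real_of_int (\<phi> (lat 0 p))" for p
  have mem: "lat m p \<in> lattice X \<longleftrightarrow> m \<in> root_lattice \<and> p \<in> dual_lattice" for m p
    by (auto simp: lattice_X)
  have \<phi>: "real_of_int (\<phi> (lat m p)) = f m + g p" if "m \<in> root_lattice" "p \<in> dual_lattice" for m p
    using add[rule_format, of "lat m 0" "lat 0 p"] that root_lattice_closed(1) dual_lattice_closed(1)
    by (simp add: mem f_def g_def)
  have f: "f m = (\<Sum>i<n. coord m i *\<^sub>R f (b i))" if "m \<in> root_lattice" for m
  proof (rule root_lattice_additive[OF _ that])
    fix x y assume "x \<in> root_lattice" "y \<in> root_lattice"
    then show "f (x + y) = f x + f y"
      using add[rule_format, of "lat x 0" "lat y 0"] dual_lattice_closed(1) by (simp add: mem f_def)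
  qed
  have g: "g p = (\<Sum>i<n. dual_coord p i *\<^sub>R g (dual i))" if "p \<in> dual_lattice" for p
  proof (rule dual_lattice_additive[OF _ that])
    fix x y assume "x \<in> dual_lattice" "y \<in> dual_lattice"
    then show "g (x + y) = g x + g y"
      using add[rule_format, of "lat 0 x" "lat 0 y"] root_lattice_closed(1) by (simp add: mem g_def)
  qed
  define m0 where "m0 = (\<Sum>i<n. g (dual i) *\<^sub>R b i)"
  define p0 where "p0 = - (\<Sum>i<n. f (b i) *\<^sub>R dual i)"
  have m0: "m0 \<in> root_lattice"
    by (auto simp: root_lattice_def m0_def g_def)
  have p0: "p0 \<in> dual_lattice"
    by (auto simp: dual_lattice_def p0_def f_def dual_coord_sum if_distrib cong: if_cong)
  have E: "Im (herm X (lat m0 p0) (lat m p)) = f m + g p" if "m \<in> root_lattice" "p \<in> dual_lattice" for m p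
  proof -
    have "inner m0 p / lam = g p"
      unfolding inner_coord g[OF that(2)] by (simp add: m0_def mult.commute)
    moreover have "inner m p0 / lam = - f m"
      unfolding inner_coord f[OF that(1)]
      by (simp add: p0_def dual_coord_sum if_distrib sum_negf cong: if_cong)
    ultimately show ?thesis by (simp add: Im_herm_lat diff_divide_distrib inner_commute[of p0])
  qed
  show "\<exists>!y. y \<in> lattice X \<and> (\<forall>x\<in>lattice X. Im (herm X y x) = of_int (\<phi> x))"
  proof (rule ex1I[of _ "lat m0 p0"])
    show "lat m0 p0 \<in> lattice X \<and> (\<forall>x\<in>lattice X. Im (herm X (lat m0 p0) x) = of_int (\<phi> x))"
      using E \<phi> m0 p0 by (auto simp: lattice_X)
    fix y assume y: "y \<in> lattice X \<and> (\<forall>x\<in>lattice X. Im (herm X y x) = of_int (\<phi> x))"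
    then obtain m p where mp: "y = lat m p" "m \<in> root_lattice" "p \<in> dual_lattice" by (auto simp: lattice_X)
    have "m = m0"
    proof (rule eq_if_coord_eq)
      fix i assume "i < n"
      then have "Im (herm X y (lat 0 (dual i))) = Im (herm X (lat m0 p0) (lat 0 (dual i)))"
        using y E[of 0 "dual i"] \<phi>[of 0 "dual i"] root_lattice_closed(1) dual_in_dual_lattice by (simp add: mem)
      then show "coord m i = coord m0 i"
        by (simp add: mp Im_herm_lat coord_def inner_commute)
    qed
    moreover have "p = p0"
    proof (rule eq_if_dual_coord_eq)
      fix i assume "i < n"
      then have "Im (herm X y (lat (b i) 0)) = Im (herm X (lat m0 p0) (lat (b i) 0))"
        using y E[of "b i" 0] \<phi>[of "b i" 0] dual_lattice_closed(1) b_in_root_lattice by (simp add: mem)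
      then show "dual_coord p i = dual_coord p0 i"
        by (simp add: mp Im_herm_lat dual_coord_def)
    qed
    ultimately show "y = lat m0 p0" by (simp add: mp)
  qed
qed

lemma ppav_X: "ppav n X"
proof -
  interpret vec_space "TYPE(complex)" n .
  have "Im (herm X x y) \<in> \<int>" if "x \<in> lattice X" "y \<in> lattice X" for x y
    using that pairing_integral
    by (auto simp: lattice_X Im_herm_lat diff_divide_distrib inner_commute[of _ "_ :: 'e"] intro!: Ints_diff)
  moreover have "vectorspace class_ring (module_vec TYPE(complex) n)" ..
  ultimately show ?thesis
    unfolding ppav_def tangent_X
    using fin_dim dim_is_n full_lattice_X hermitian_form_X positive_definite_X unimodular_X by blast
qed

text \<open>The quadratic form of \<open>Z\<close> is, up to the factor \<open>lam\<close>, the squared length of the vector with the given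
  coordinates in the dual basis.\<close>

lemma siegel_Zt: "Zt \<in> siegel_space n"
  unfolding siegel_space_def mem_Collect_eq Im_Zt
proof (intro conjI ballI impI)
  show "Zt \<in> carrier_mat n n" using Z_carrier by (simp add: Zt_def)
  show "transpose_mat Zt = Zt"
    using Z_carrier Z_symmetric by (intro eq_matI) (auto simp: Zt_def)
  fix x :: "real vec" assume x: "x \<in> carrier_vec n" "x \<noteq> 0\<^sub>v n"
  define q where "q = (\<Sum>i<n. x $ i *\<^sub>R dual i)"
  have dq: "dual_coord q i = x $ i" if "i < n" for i
    using that by (simp add: q_def dual_coord_sum if_distrib cong: if_cong)
  have "q \<noteq> 0"
  proof
    assume "q = 0"
    then have "x = 0\<^sub>v n" using x dq by (intro eq_vecI) auto
    then show False using x by simp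
  qed
  have "coord q i = (\<Sum>j<n. Z $$ (i, j) * x $ j)" if "i < n" for i
  proof -
    have "coord (dual j) i = Z $$ (i, j)" if "j < n" for j
      using that \<open>i < n\<close> by (simp add: dual_def Z_symmetric)
    then show ?thesis by (simp add: q_def coord_sum mult.commute)
  qed
  then have "x \<bullet> (Im \<tau> \<cdot>\<^sub>m Z *\<^sub>v x) = Im \<tau> * (\<Sum>i<n. coord q i * dual_coord q i)"
    using x Z_carrier by (simp add: scalar_prod_def lessThan_atLeast0 dq sum_distrib_left ac_simps)
  also have "\<dots> = Im \<tau> * inner q q / lam" by (simp add: inner_coord)
  also have "\<dots> > 0" using \<open>q \<noteq> 0\<close> Im_tau_gt0 lam_pos by simp
  finally show "0 < x \<bullet> (Im \<tau> \<cdot>\<^sub>m Z *\<^sub>v x)" .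
qed

text \<open>The complex linear extension of an isometry, restricted to the carrier because the group of
  automorphisms consists of extensional functions.\<close>

definition act :: "('e \<Rightarrow> 'e) \<Rightarrow> complex vec \<Rightarrow> complex vec" where
  "act g = restrict (\<lambda>v. cvec (g (re_part v)) (g (im_part v))) (carrier_vec n)"

lemma act_cvec [simp]: "act g (cvec x y) = cvec (g x) (g y)"
  by (simp add: act_def)

lemma act_lat: "g \<in> carrier W \<Longrightarrow> act g (lat m p) = lat (g m) (g p)"
  using weyl_linear by (simp add: lat_def linear_add linear_scale)

lemma act_bij:
  assumes "g \<in> carrier W"
  shows "bij_betw (act g) (carrier_vec n) (carrier_vec n)"
proof (rule bij_betwI')
  fix u v :: "complex vec" assume "u \<in> carrier_vec n" "v \<in> carrier_vec n"
  then obtain x y x' y' where uv: "u = cvec x y" "v = cvec x' y'" by (meson cvec_cases)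
  show "act g u = act g v \<longleftrightarrow> u = v"
    using bij_is_inj[OF weyl_bij[OF assms]] by (auto simp: uv inj_eq)
  show "act g u \<in> carrier_vec n" by (simp add: uv)
next
  fix v :: "complex vec" assume "v \<in> carrier_vec n"
  then obtain x y where v: "v = cvec x y" by (rule cvec_cases)
  obtain x' y' where "g x' = x" "g y' = y"
    using bij_is_surj[OF weyl_bij[OF assms]] by (metis surjD)
  then show "\<exists>u\<in>carrier_vec n. v = act g u"
    by (intro bexI[of _ "cvec x' y'"]) (simp_all add: v)
qed

lemma act_automorphism:
  assumes g: "g \<in> carrier W"
  shows "act g \<in> carrier (ppav_aut X)"
proof -
  have "act g \<in> module_hom class_ring (module_vec TYPE(complex) n) (module_vec TYPE(complex) n)"
    unfolding module_hom_def module_vec_simps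
    using weyl_linear[OF g]
    by (auto simp: linear_add linear_diff linear_scale act_def elim!: cvec_cases)
  moreover have "act g ` lattice X = lattice X"
  proof -
    have "act g ` lattice X = {lat m p | m p. m \<in> g ` root_lattice \<and> p \<in> g ` dual_lattice}"
      by (auto simp: lattice_X act_lat[OF g] image_iff) (metis act_lat[OF g])
    then show ?thesis by (simp add: lattice_X weyl_root_lattice[OF g] weyl_dual_lattice[OF g])
  qed
  moreover have "herm X (act g u) (act g v) = herm X u v" if "u \<in> carrier_vec n" "v \<in> carrier_vec n" for u v
    using that by (auto elim!: cvec_cases simp: herm_cvec weyl_inner[OF g])
  ultimately show ?thesis
    using act_bij[OF g]
    by (auto simp: ppav_aut_def BijGroup_def Bij_def ppav_iso_def module_vec_simps act_def)
qed

lemma act_hom: "act \<in> hom W (ppav_aut X)"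
proof (rule homI)
  fix g h assume g: "g \<in> carrier W" and h: "h \<in> carrier W"
  have "act g \<in> Bij (carrier_vec n)" "act h \<in> Bij (carrier_vec n)"
    using act_bij[OF g] act_bij[OF h] by (auto simp: Bij_def act_def)
  then have "act g \<otimes>\<^bsub>ppav_aut X\<^esub> act h = compose (carrier_vec n) (act g) (act h)"
    by (simp add: ppav_aut_def BijGroup_def module_vec_simps)
  also have "\<dots> = act (g \<circ> h)"
    by (rule ext) (auto simp: compose_def act_def)
  finally show "act (g \<otimes>\<^bsub>W\<^esub> h) = act g \<otimes>\<^bsub>ppav_aut X\<^esub> act h"
    using weyl_mult[OF g h] by simp
qed (rule act_automorphism)

lemma act_inj: "inj_on act (carrier W)"
proof (rule inj_onI, rule ext)
  fix g h x assume "act g = act h"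
  then have "act g (cvec x 0) = act h (cvec x 0)" by simp
  then show "g x = h x" by simp
qed

lemma additive_subgroup_vecI:
  assumes "L \<subseteq> carrier_vec n" "0\<^sub>v n \<in> L" "\<And>u v. u \<in> L \<Longrightarrow> v \<in> L \<Longrightarrow> u + v \<in> L"
    "\<And>u. u \<in> L \<Longrightarrow> \<exists>v\<in>L. v + u = 0\<^sub>v n"
  shows "additive_subgroup L (module_vec TYPE(complex) n)"
proof -
  interpret vec_space "TYPE(complex)" n .
  have inv: "\<ominus>\<^bsub>V\<^esub> u \<in> L" if u: "u \<in> L" for u
  proof -
    obtain v where v: "v \<in> L" "v + u = 0\<^sub>v n" using assms(4)[OF u] by blast
    have "\<ominus>\<^bsub>V\<^esub> u = v"
      using v u assms(1) by (intro M.minus_equality) auto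
    then show ?thesis using v by simp
  qed
  show ?thesis
    unfolding additive_subgroup_def
    by (rule subgroup.intro) (use assms inv in \<open>auto simp: module_vec_simps a_inv_def\<close>)
qed

lemma rho_decomposable_X: "rho_decomposable n W root_lattice (\<lambda>w x. w x) X"
proof -
  have neg: "m \<in> root_lattice \<Longrightarrow> \<exists>k\<in>root_lattice. k + m = 0"
      "p \<in> dual_lattice \<Longrightarrow> \<exists>k\<in>dual_lattice. k + p = 0" for m p
    using root_lattice_closed(3) dual_lattice_closed(3) by (metis add.left_inverse)+
  define L1 where "L1 = (\<lambda>m. lat m 0) ` root_lattice"
  define L2 where "L2 = lat 0 ` dual_lattice"
  have "additive_subgroup L1 (module_vec TYPE(complex) n)"
    using root_lattice_closed neg(1)
    by (intro additive_subgroup_vecI) (auto simp: L1_def lat_zero)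
  moreover have "additive_subgroup L2 (module_vec TYPE(complex) n)"
    using dual_lattice_closed neg(2)
    by (intro additive_subgroup_vecI) (auto simp: L2_def lat_zero)
  moreover have "L1 <+>\<^bsub>module_vec TYPE(complex) n\<^esub> L2 = lattice X"
    by (auto simp: set_add_def' module_vec_simps L1_def L2_def lattice_X)
  moreover have "L1 \<inter> L2 = {\<zero>\<^bsub>module_vec TYPE(complex) n\<^esub>}"
    using root_lattice_closed(1) dual_lattice_closed(1) by (auto simp: L1_def L2_def module_vec_simps lat_zero)
  moreover have "\<forall>g\<in>carrier W. act g ` L1 \<subseteq> L1 \<and> act g ` L2 \<subseteq> L2"
  proof
    fix g assume g: "g \<in> carrier W"
    have "g 0 = 0" using weyl_linear[OF g] by (rule linear_0)
    moreover have "m \<in> root_lattice \<Longrightarrow> g m \<in> root_lattice" "p \<in> dual_lattice \<Longrightarrow> g p \<in> dual_lattice" for m p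
      using weyl_root_lattice[OF g] weyl_dual_lattice[OF g] by blast+
    ultimately show "act g ` L1 \<subseteq> L1 \<and> act g ` L2 \<subseteq> L2"
      by (auto simp: L1_def L2_def act_lat[OF g])
  qed
  moreover have "isotropic X L1" "isotropic X L2"
    by (auto simp: isotropic_def L1_def L2_def Im_herm_lat)
  moreover have "bij_betw (\<lambda>m. lat m 0) root_lattice L1"
    by (auto simp: bij_betw_def inj_on_def L1_def)
  moreover have "\<forall>g\<in>carrier W. \<forall>x\<in>root_lattice. lat (g x) 0 = act g (lat x 0)"
    using weyl_linear by (simp add: act_lat linear_0)
  ultimately show ?thesis
    unfolding rho_decomposable_def tangent_X
    by (intro conjI ppav_X exI[of _ act] act_hom act_inj exI[of _ L1] exI[of _ L2] exI[of _ "\<lambda>m. lat m 0"])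
      (simp_all add: module_vec_simps)
qed

definition herm_values :: "complex set" where
  "herm_values = (\<lambda>(v, w). herm X v w) ` (lattice X \<times> lattice X)"

lemma countable_herm_values: "countable herm_values"
proof -
  have "countable (UNIV :: int vec set)"
  proof -
    have "UNIV = range (vec_of_list :: int list \<Rightarrow> int vec)"
      by (metis surj_def vec_list)
    then show ?thesis by (metis countable_image countableI_type)
  qed
  then have "countable ((\<lambda>(a, c). map_vec complex_of_int a + Zt *\<^sub>v map_vec complex_of_int c) ` (UNIV \<times> UNIV))"
    by (intro countable_image countable_SIGMA)
  moreover have "lattice X \<subseteq> (\<lambda>(a, c). map_vec complex_of_int a + Zt *\<^sub>v map_vec complex_of_int c) ` (UNIV \<times> UNIV)"
    by (auto simp: riemann_ppav_def)
  ultimately have "countable (lattice X)" by (rule countable_subset[rotated])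
  then show ?thesis unfolding herm_values_def by (intro countable_image countable_SIGMA)
qed

text \<open>With the first simple root \<open>a\<close> and the dual vector \<open>p\<close>, the value of the Hermitian form at
  \<open>(a, a)\<close> reveals \<open>Im \<tau>\<close>, and its value at \<open>(a, \<tau> p)\<close> is \<open>\<tau> / Im \<tau>\<close>.\<close>

lemma tau_from_herm_values:
  "\<exists>s\<in>herm_values. \<exists>u\<in>herm_values. \<tau> = u * of_real (inner (b 0) (b 0) / lam) / s"
proof -
  let ?s = "herm X (lat (b 0) 0) (lat (b 0) 0)" and ?u = "herm X (lat (b 0) 0) (lat 0 (dual 0))"
  have "b 0 \<in> root_lattice" "dual 0 \<in> dual_lattice"
    using b_in_root_lattice dual_in_dual_lattice n_pos by auto
  then have "lat (b 0) 0 \<in> lattice X" "lat 0 (dual 0) \<in> lattice X"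
    using root_lattice_closed(1) dual_lattice_closed(1) by (auto simp: lattice_X)
  then have mem: "?s \<in> herm_values" "?u \<in> herm_values" by (auto simp: herm_values_def)
  have "inner (b 0) (dual 0) = lam" using inner_dual_b[of 0 0] n_pos by (simp add: inner_commute)
  then have u: "?u = \<tau> / of_real (Im \<tau>)"
    using Im_tau_gt0 by (simp add: lat_def herm_cvec complex_eq_iff)
  have s: "?s = of_real (inner (b 0) (b 0) / (lam * Im \<tau>))"
    by (simp add: lat_def herm_cvec complex_eq_iff)
  have "inner (b 0) (b 0) \<noteq> 0" using b_nonzero[of 0] n_pos by simp
  then have "\<tau> = ?u * of_real (inner (b 0) (b 0) / lam) / ?s"
    unfolding u s using Im_tau_gt0 by (simp add: field_simps)
  then show ?thesis using mem by blast
qed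

end

lemma herm_values_isomorphic:
  assumes "riemann_frame R n \<alpha> Z lam \<tau>" "riemann_frame R n \<alpha> Z lam \<tau>'"
    and iso: "ppav_isomorphic (riemann_ppav n (riemann_frame.Zt Z \<tau>)) (riemann_ppav n (riemann_frame.Zt Z \<tau>'))"
  shows "riemann_frame.herm_values n Z \<tau>' \<subseteq> riemann_frame.herm_values n Z \<tau>"
proof -
  interpret A: riemann_frame R n \<alpha> Z lam \<tau> by fact
  interpret B: riemann_frame R n \<alpha> Z lam \<tau>' by fact
  obtain f where f: "ppav_iso f A.X B.X" using iso by (auto simp: ppav_isomorphic_def)
  have sub: "lattice A.X \<subseteq> carrier_vec n" by (auto simp: A.lattice_X)
  show ?thesis
    unfolding A.herm_values_def B.herm_values_def
  proof clarify
    fix v w assume "v \<in> lattice B.X" "w \<in> lattice B.X"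
    then obtain v' w' where "v' \<in> lattice A.X" "w' \<in> lattice A.X" "v = f v'" "w = f w'"
      using f unfolding ppav_iso_def by (metis imageE)
    moreover from this sub have "herm B.X v w = herm A.X v' w'"
      using f unfolding ppav_iso_def by (auto simp: module_vec_simps)
    ultimately show "herm B.X v w \<in> (\<lambda>(v, w). herm A.X v w) ` (lattice A.X \<times> lattice A.X)" by force
  qed
qed

text \<open>If two members of the family are isomorphic, the parameter of the second one is computed from
  two values of the Hermitian form of the first one, and there are only countably many such pairs.\<close>

lemma (in root_frame) countable_isomorphic:
  assumes "0 < Im \<tau>"
  shows "countable {\<tau>'\<in>upper_half_plane. ppav_isomorphic (riemann_ppav n (\<tau> \<cdot>\<^sub>m map_mat complex_of_real Z))
     (riemann_ppav n (\<tau>' \<cdot>\<^sub>m map_mat complex_of_real Z))}" (is "countable ?S")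
proof -
  interpret A: riemann_frame R n \<alpha> Z lam \<tau> using assms by unfold_locales
  have "?S \<subseteq> (\<lambda>(s, u). u * of_real (inner (b 0) (b 0) / lam) / s) ` (A.herm_values \<times> A.herm_values)"
  proof clarify
    fix \<tau>' assume t: "\<tau>' \<in> upper_half_plane" and iso: "ppav_isomorphic (riemann_ppav n (\<tau> \<cdot>\<^sub>m map_mat complex_of_real Z))
     (riemann_ppav n (\<tau>' \<cdot>\<^sub>m map_mat complex_of_real Z))"
    interpret B: riemann_frame R n \<alpha> Z lam \<tau>' using t by unfold_locales (simp add: upper_half_plane_def)
    have "B.herm_values \<subseteq> A.herm_values"
      using herm_values_isomorphic[OF A.riemann_frame_axioms B.riemann_frame_axioms] iso
      by (simp add: A.Zt_def B.Zt_def)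
    then show "\<tau>' \<in> (\<lambda>(s, u). u * of_real (inner (b 0) (b 0) / lam) / s) ` (A.herm_values \<times> A.herm_values)"
      using B.tau_from_herm_values by (force simp: image_iff)
  qed
  then show ?thesis
    by (rule countable_subset) (intro countable_image countable_SIGMA A.countable_herm_values)
qed

section \<open>Decomposable abelian varieties\<close>

lemma ppav_isomorphic_sym:
  assumes f: "ppav_iso f X Y" and X: "Module.module class_ring (tangent X)"
    and L: "lattice X \<subseteq> carrier (tangent X)"
  shows "ppav_isomorphic Y X"
proof -
  interpret Module.module class_ring "tangent X" by (rule X)
  let ?V = "carrier (tangent X)"
  define h where "h = inv_into ?V f"
  have bij: "bij_betw f ?V (carrier (tangent Y))" using f by (simp add: ppav_iso_def)
  have fh: "f (h y) = y" and hc: "h y \<in> ?V" if "y \<in> carrier (tangent Y)" for y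
    using that bij unfolding h_def by (auto simp: bij_betw_def f_inv_into_f inv_into_into)
  have hf: "h (f x) = x" if "x \<in> ?V" for x
    using that bij unfolding h_def by (simp add: bij_betw_def)
  have add: "f (x \<oplus>\<^bsub>tangent X\<^esub> y) = f x \<oplus>\<^bsub>tangent Y\<^esub> f y" if "x \<in> ?V" "y \<in> ?V" for x y
    using f that by (auto simp: ppav_iso_def module_hom_def)
  have smult: "f (c \<odot>\<^bsub>tangent X\<^esub> x) = c \<odot>\<^bsub>tangent Y\<^esub> f x" if "x \<in> ?V" for x c
    using f that by (auto simp: ppav_iso_def module_hom_def)
  have "h \<in> module_hom class_ring (tangent Y) (tangent X)"
    unfolding module_hom_def
  proof (intro CollectI conjI allI impI)
    fix x y assume xy: "x \<in> carrier (tangent Y) \<and> y \<in> carrier (tangent Y)"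
    then have "x \<oplus>\<^bsub>tangent Y\<^esub> y = f (h x \<oplus>\<^bsub>tangent X\<^esub> h y)" using add fh hc by simp
    then show "h (x \<oplus>\<^bsub>tangent Y\<^esub> y) = h x \<oplus>\<^bsub>tangent X\<^esub> h y" using hf hc xy by simp
  next
    fix c x assume x: "(c::complex) \<in> carrier class_ring \<and> x \<in> carrier (tangent Y)"
    then have "c \<odot>\<^bsub>tangent Y\<^esub> x = f (c \<odot>\<^bsub>tangent X\<^esub> h x)" using smult fh hc by simp
    then show "h (c \<odot>\<^bsub>tangent Y\<^esub> x) = c \<odot>\<^bsub>tangent X\<^esub> h x" using hf hc x by simp
  qed (use hc in auto)
  moreover have "bij_betw h (carrier (tangent Y)) ?V"
    unfolding h_def by (rule bij_betw_inv_into[OF bij])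
  moreover have "h ` lattice Y = lattice X"
  proof -
    have "lattice Y = f ` lattice X" using f by (simp add: ppav_iso_def)
    moreover have "h (f x) = x" if "x \<in> lattice X" for x using hf L that by blast
    ultimately show ?thesis by (simp add: image_image)
  qed
  moreover have "herm X (h u) (h v) = herm Y u v" if "u \<in> carrier (tangent Y)" "v \<in> carrier (tangent Y)" for u v
  proof -
    have "herm Y (f (h u)) (f (h v)) = herm X (h u) (h v)"
      using f hc that by (simp add: ppav_iso_def)
    then show ?thesis using fh that by simp
  qed
  ultimately show ?thesis unfolding ppav_isomorphic_def ppav_iso_def by blast
qed

text \<open>The \<open>(-1)\<close>-eigenspace of a reflection is a line.\<close>

lemma reflection_eigenvector:
  assumes "reflection a x + x = 0" "a \<noteq> 0"
  shows "x = (inner x a / inner a a) *\<^sub>R a"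
proof -
  have "2 *\<^sub>R x = 2 *\<^sub>R ((inner x a / inner a a) *\<^sub>R a)"
    using assms(1) by (simp add: reflection_def algebra_simps scaleR_2)
  then show ?thesis unfolding scaleR_cancel_left by simp
qed

text \<open>A decomposition of an abelian variety, given by an equivariant isomorphism \<open>\<psi>\<close> from the root
  lattice onto the first summand.\<close>

locale decomposed_ppav = root_frame R n \<alpha> Z lam
  for R :: "'e::euclidean_space set" and n \<alpha> Z lam +
  fixes X :: "'v polarized_torus" and T :: "('e \<Rightarrow> 'e) \<Rightarrow> 'v \<Rightarrow> 'v" and L1 L2 :: "'v set" and \<psi> :: "'e \<Rightarrow> 'v"
  assumes ppav: "ppav n X"
    and T_hom: "T \<in> hom (weyl_group R) (ppav_aut X)"
    and L1: "additive_subgroup L1 (tangent X)"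
    and L2: "additive_subgroup L2 (tangent X)"
    and lattice_sum: "L1 <+>\<^bsub>tangent X\<^esub> L2 = lattice X"
    and lattice_int: "L1 \<inter> L2 = {\<zero>\<^bsub>tangent X\<^esub>}"
    and invariant: "\<And>g. g \<in> carrier (weyl_group R) \<Longrightarrow> T g ` L1 \<subseteq> L1 \<and> T g ` L2 \<subseteq> L2"
    and isotropic1: "isotropic X L1" and isotropic2: "isotropic X L2"
    and psi_bij: "bij_betw \<psi> root_lattice L1"
    and psi_add: "\<And>x y. x \<in> root_lattice \<Longrightarrow> y \<in> root_lattice \<Longrightarrow> \<psi> (x + y) = \<psi> x \<oplus>\<^bsub>tangent X\<^esub> \<psi> y"
    and psi_equivariant: "\<And>g x. g \<in> carrier (weyl_group R) \<Longrightarrow> x \<in> root_lattice \<Longrightarrow> \<psi> (g x) = T g (\<psi> x)"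
begin

abbreviation V where "V \<equiv> carrier (tangent X)"
abbreviation plus_V (infixl "\<oplus>\<^sub>V" 65) where "x \<oplus>\<^sub>V y \<equiv> x \<oplus>\<^bsub>tangent X\<^esub> y"
abbreviation smult_V (infixr "\<odot>\<^sub>V" 70) where "c \<odot>\<^sub>V x \<equiv> c \<odot>\<^bsub>tangent X\<^esub> x"
abbreviation neg_V where "neg_V x \<equiv> \<ominus>\<^bsub>tangent X\<^esub> x"
abbreviation H where "H \<equiv> herm X"
abbreviation E where "E x y \<equiv> Im (herm X x y)"

sublocale V: vectorspace class_ring "tangent X"
  using ppav by (simp add: ppav_def)

lemma smult_closed [simp]: "x \<in> V \<Longrightarrow> c \<odot>\<^sub>V x \<in> V"
  using V.smult_closed[of c x] by simp

lemma H_cnj: "u \<in> V \<Longrightarrow> v \<in> V \<Longrightarrow> H v u = cnj (H u v)"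
  and H_add: "u \<in> V \<Longrightarrow> v \<in> V \<Longrightarrow> w \<in> V \<Longrightarrow> H u (v \<oplus>\<^sub>V w) = H u v + H u w"
  and H_smult: "u \<in> V \<Longrightarrow> v \<in> V \<Longrightarrow> H u (c \<odot>\<^sub>V v) = c * H u v"
  using ppav unfolding ppav_def hermitian_form_def by blast+

lemma E_antisym: "u \<in> V \<Longrightarrow> v \<in> V \<Longrightarrow> E v u = - E u v"
  using H_cnj[of u v] by simp

lemma H_zero: "u \<in> V \<Longrightarrow> H u \<zero>\<^bsub>tangent X\<^esub> = 0"
  using H_add[of u "\<zero>\<^bsub>tangent X\<^esub>" "\<zero>\<^bsub>tangent X\<^esub>"] by simp

lemma H_neg: "u \<in> V \<Longrightarrow> v \<in> V \<Longrightarrow> H u (neg_V v) = - H u v"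
  using H_add[of u v "neg_V v"] H_zero[of u] by (simp add: V.M.r_neg eq_neg_iff_add_eq_0 add.commute)

lemma H_finsum:
  "finite A \<Longrightarrow> f \<in> A \<rightarrow> V \<Longrightarrow> u \<in> V \<Longrightarrow> H u (finsum (tangent X) f A) = (\<Sum>i\<in>A. H u (f i))"
proof (induction A rule: finite_induct)
  case (insert i A)
  then show ?case by (simp add: V.M.finsum_insert H_add)
qed (simp add: H_zero)

lemma H_positive: "v \<in> V \<Longrightarrow> v \<noteq> \<zero>\<^bsub>tangent X\<^esub> \<Longrightarrow> Re (H v v) > 0"
  using ppav unfolding ppav_def positive_definite_def by blast

text \<open>This is the tool for all equations in \<open>V\<close>: pairing with a vector turns them, including finite
  sums and scalar multiples in the module, into equations between complex numbers.\<close>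

lemma H_nondegenerate:
  assumes "x \<in> V" "y \<in> V" "\<And>u. u \<in> V \<Longrightarrow> H u x = H u y"
  shows "x = y"
proof (rule ccontr)
  assume "x \<noteq> y"
  let ?d = "x \<oplus>\<^sub>V neg_V y"
  have d: "?d \<in> V" using assms by simp
  have "?d \<noteq> \<zero>\<^bsub>tangent X\<^esub>"
    using \<open>x \<noteq> y\<close> assms by (metis V.M.minus_equality V.M.minus_minus V.M.a_inv_closed)
  moreover have "H ?d ?d = 0"
    using assms(3)[OF d] assms(1,2) d by (simp add: H_add H_neg)
  ultimately show False using H_positive[OF d] by simp
qed

text \<open>Real linearity of a map into the complex module \<open>V\<close>, expressed through the pairings; the type of
  \<open>V\<close> carries no vector space structure of its own.\<close>

definition rlin :: "('e \<Rightarrow> 'v) \<Rightarrow> bool" where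
  "rlin F \<longleftrightarrow> (\<forall>x. F x \<in> V) \<and> (\<forall>u\<in>V. linear (\<lambda>x. H u (F x)))"

lemma rlin_closed: "rlin F \<Longrightarrow> F x \<in> V"
  and rlin_H: "rlin F \<Longrightarrow> u \<in> V \<Longrightarrow> linear (\<lambda>x. H u (F x))"
  by (simp_all add: rlin_def)

lemma rlin_eqI_b:
  assumes "rlin F" "rlin F'" "\<And>i. i < n \<Longrightarrow> F (b i) = F' (b i)"
  shows "F x = F' x"
proof (rule H_nondegenerate)
  fix u assume u: "u \<in> V"
  show "H u (F x) = H u (F' x)"
    using linear_b_expansion[OF rlin_H[OF assms(1) u], of x] linear_b_expansion[OF rlin_H[OF assms(2) u], of x] assms(3)
    by simp
qed (use assms rlin_closed in auto)

lemma rlin_eqI_dual: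
  assumes "rlin F" "rlin F'" "\<And>i. i < n \<Longrightarrow> F (dual i) = F' (dual i)"
  shows "F x = F' x"
proof (rule H_nondegenerate)
  fix u assume u: "u \<in> V"
  show "H u (F x) = H u (F' x)"
    using linear_dual_expansion[OF rlin_H[OF assms(1) u], of x] linear_dual_expansion[OF rlin_H[OF assms(2) u], of x] assms(3)
    by simp
qed (use assms rlin_closed in auto)

lemma rlin_combination:
  assumes c: "\<And>i. linear (\<lambda>x. c x i)" and v: "\<And>i. i < n \<Longrightarrow> v i \<in> V"
  defines "F \<equiv> \<lambda>x. \<Oplus>\<^bsub>tangent X\<^esub>i\<in>{..<n}. complex_of_real (c x i) \<odot>\<^sub>V v i"
  shows "rlin F" "u \<in> V \<Longrightarrow> H u (F x) = (\<Sum>i<n. c x i *\<^sub>R H u (v i))"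
proof -
  have H: "H u (F x) = (\<Sum>i<n. c x i *\<^sub>R H u (v i))" if "u \<in> V" for u x
    using v that by (simp add: F_def H_finsum Pi_def H_smult scaleR_conv_of_real)
  then show "u \<in> V \<Longrightarrow> H u (F x) = (\<Sum>i<n. c x i *\<^sub>R H u (v i))" by blast
  have "linear (\<lambda>x. \<Sum>i<n. c x i *\<^sub>R H u (v i))" for u
    using linear_add[OF c] linear_scale[OF c]
    by (intro linear_compose_sum ballI linearI) (simp_all add: scaleR_add_left)
  moreover have "F x \<in> V" for x
    unfolding F_def using v by (intro V.M.finsum_closed) auto
  ultimately show "rlin F" by (simp add: rlin_def H)
qed

lemma extend_from_root_lattice:
  assumes "\<And>m. m \<in> root_lattice \<Longrightarrow> f m \<in> V"
    and "\<And>x y. x \<in> root_lattice \<Longrightarrow> y \<in> root_lattice \<Longrightarrow> f (x + y) = f x \<oplus>\<^sub>V f y"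
  obtains F where "rlin F" "\<And>m. m \<in> root_lattice \<Longrightarrow> F m = f m"
proof -
  define F where "F = (\<lambda>x. \<Oplus>\<^bsub>tangent X\<^esub>i\<in>{..<n}. complex_of_real (coord x i) \<odot>\<^sub>V f (b i))"
  note F = rlin_combination[of coord "\<lambda>i. f (b i)", OF coord_linear, folded F_def]
  show thesis
  proof (rule that[of F])
    show rl: "rlin F" using F(1) assms(1) b_in_root_lattice by blast
    fix m assume m: "m \<in> root_lattice"
    show "F m = f m"
    proof (rule H_nondegenerate)
      fix u assume u: "u \<in> V"
      have "H u (f m) = (\<Sum>i<n. coord m i *\<^sub>R H u (f (b i)))"
        by (rule root_lattice_additive[OF _ m]) (simp add: assms u H_add)
      then show "H u (F m) = H u (f m)" using F(2)[OF _ u] assms(1) b_in_root_lattice by (simp add: F_def)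
    qed (use rl rlin_closed assms(1) m in auto)
  qed
qed

lemma extend_from_dual_lattice:
  assumes "\<And>m. m \<in> dual_lattice \<Longrightarrow> f m \<in> V"
    and "\<And>x y. x \<in> dual_lattice \<Longrightarrow> y \<in> dual_lattice \<Longrightarrow> f (x + y) = f x \<oplus>\<^sub>V f y"
  obtains F where "rlin F" "\<And>m. m \<in> dual_lattice \<Longrightarrow> F m = f m"
proof -
  define F where "F = (\<lambda>x. \<Oplus>\<^bsub>tangent X\<^esub>i\<in>{..<n}. complex_of_real (dual_coord x i) \<odot>\<^sub>V f (dual i))"
  note F = rlin_combination[of dual_coord "\<lambda>i. f (dual i)", OF dual_coord_linear, folded F_def]
  show thesis
  proof (rule that[of F])
    show rl: "rlin F" using F(1) assms(1) dual_in_dual_lattice by blast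
    fix m assume m: "m \<in> dual_lattice"
    show "F m = f m"
    proof (rule H_nondegenerate)
      fix u assume u: "u \<in> V"
      have "H u (f m) = (\<Sum>i<n. dual_coord m i *\<^sub>R H u (f (dual i)))"
        by (rule dual_lattice_additive[OF _ m]) (simp add: assms u H_add)
      then show "H u (F m) = H u (f m)" using F(2)[OF _ u] assms(1) dual_in_dual_lattice by (simp add: F_def)
    qed (use rl rlin_closed assms(1) m in auto)
  qed
qed

lemma L1_V: "x \<in> L1 \<Longrightarrow> x \<in> V" and L2_V: "x \<in> L2 \<Longrightarrow> x \<in> V"
  using additive_subgroup.a_subset[OF L1] additive_subgroup.a_subset[OF L2] by auto

lemma lattice_iff: "x \<in> lattice X \<longleftrightarrow> (\<exists>m\<in>root_lattice. \<exists>l\<in>L2. x = \<psi> m \<oplus>\<^sub>V l)"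
  using psi_bij unfolding lattice_sum[symmetric] set_add_def' bij_betw_def by auto

lemma psi_L1: "m \<in> root_lattice \<Longrightarrow> \<psi> m \<in> L1"
  using psi_bij by (auto simp: bij_betw_def)

lemma psi_V: "m \<in> root_lattice \<Longrightarrow> \<psi> m \<in> V"
  using psi_L1 L1_V by blast

lemma psi_zero: "\<psi> 0 = \<zero>\<^bsub>tangent X\<^esub>"
  using psi_add[of 0 0] psi_V[of 0] root_lattice_closed(1)
  by (metis V.M.add.l_cancel_one add_0)

lemma psi_in_lattice: "m \<in> root_lattice \<Longrightarrow> \<psi> m \<in> lattice X"
  unfolding lattice_iff using additive_subgroup.zero_closed[OF L2] psi_V by force

lemma L2_in_lattice: "l \<in> L2 \<Longrightarrow> l \<in> lattice X"
  unfolding lattice_iff using root_lattice_closed(1) psi_zero L2_V by force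

lemma lattice_V: "x \<in> lattice X \<Longrightarrow> x \<in> V"
  unfolding lattice_iff using psi_V L2_V by auto

lemma E_integral: "x \<in> lattice X \<Longrightarrow> y \<in> lattice X \<Longrightarrow> E x y \<in> \<int>"
  using ppav unfolding ppav_def by blast

lemma E_psi_psi: "m \<in> root_lattice \<Longrightarrow> m' \<in> root_lattice \<Longrightarrow> E (\<psi> m) (\<psi> m') = 0"
  using isotropic1 psi_L1 unfolding isotropic_def by blast

lemma E_L2_L2: "l \<in> L2 \<Longrightarrow> l' \<in> L2 \<Longrightarrow> E l l' = 0"
  using isotropic2 unfolding isotropic_def by blast

lemma unimodular:
  fixes \<phi> :: "'v \<Rightarrow> int"
  assumes "\<And>x y. x \<in> lattice X \<Longrightarrow> y \<in> lattice X \<Longrightarrow> \<phi> (x \<oplus>\<^sub>V y) = \<phi> x + \<phi> y"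
  shows "\<exists>!y. y \<in> lattice X \<and> (\<forall>x\<in>lattice X. E y x = of_int (\<phi> x))"
  using ppav assms unfolding ppav_def unimodular_on_def by blast

text \<open>This is the uniqueness part of unimodularity, applied to the functional that both vectors
  represent.\<close>

lemma lattice_nondegenerate:
  assumes y: "y \<in> lattice X" "y' \<in> lattice X" and eq: "\<And>x. x \<in> lattice X \<Longrightarrow> E y x = E y' x"
  shows "y = y'"
proof -
  have fl: "of_int \<lfloor>E y x\<rfloor> = E y x" if "x \<in> lattice X" for x
    using E_integral[OF y(1) that] by simp
  have "\<lfloor>E y (x1 \<oplus>\<^sub>V x2)\<rfloor> = \<lfloor>E y x1\<rfloor> + \<lfloor>E y x2\<rfloor>" if "x1 \<in> lattice X" "x2 \<in> lattice X" for x1 x2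
    using that y lattice_V E_integral by (auto simp: H_add elim!: Ints_cases)
  from unimodular[OF this] fl eq y show ?thesis by metis
qed

lemma L2_nondegenerate:
  assumes l: "l \<in> L2" "l' \<in> L2" and eq: "\<And>m. m \<in> root_lattice \<Longrightarrow> E (\<psi> m) l = E (\<psi> m) l'"
  shows "l = l'"
proof (rule lattice_nondegenerate)
  fix x assume "x \<in> lattice X"
  then obtain m k where x: "m \<in> root_lattice" "k \<in> L2" "x = \<psi> m \<oplus>\<^sub>V k" by (auto simp: lattice_iff)
  then show "E l x = E l' x"
    using l eq[of m] psi_V L2_V E_L2_L2 E_antisym[of "\<psi> m" l] E_antisym[of "\<psi> m" l'] by (simp add: H_add)
qed (use l L2_in_lattice in auto)

lemma decomposition_unique:
  assumes m: "m \<in> root_lattice" "m' \<in> root_lattice" and l: "l \<in> L2" "l' \<in> L2"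
    and eq: "\<psi> m \<oplus>\<^sub>V l = \<psi> m' \<oplus>\<^sub>V l'"
  shows "m = m'"
proof -
  let ?d = "\<psi> m \<oplus>\<^sub>V neg_V (\<psi> m')"
  have V: "\<psi> m \<in> V" "\<psi> m' \<in> V" "l \<in> V" "l' \<in> V" using m l psi_V L2_V by auto
  have "?d = l' \<oplus>\<^sub>V neg_V l"
  proof (rule H_nondegenerate)
    fix u assume u: "u \<in> V"
    then show "H u ?d = H u (l' \<oplus>\<^sub>V neg_V l)"
      using arg_cong[OF eq, of "H u"] V by (simp add: H_add H_neg algebra_simps)
  qed (use V in auto)
  moreover have "?d \<in> L1"
    using L1 psi_L1 m by (simp add: additive_subgroup.a_closed additive_subgroup.a_inv_closed)
  moreover have "l' \<oplus>\<^sub>V neg_V l \<in> L2"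
    using L2 l by (simp add: additive_subgroup.a_closed additive_subgroup.a_inv_closed)
  ultimately have "?d = \<zero>\<^bsub>tangent X\<^esub>" using lattice_int by auto
  then have "\<psi> m = \<psi> m'"
    using V by (metis V.M.minus_equality V.M.minus_minus V.M.a_inv_closed)
  then show ?thesis using psi_bij m by (auto simp: bij_betw_def inj_on_eq_iff)
qed

text \<open>Extend the functional \<open>inner _ p / lam\<close> from the first summand to the whole lattice by 0 on the
  second summand. Unimodularity represents it by a lattice vector, and its component in the
  second summand represents the same functional on the first one, which is isotropic. The sign
  accounts for the order of the arguments of the alternating form.\<close>

lemma ex_dual_vector:
  assumes p: "p \<in> dual_lattice"
  shows "\<exists>!d. d \<in> L2 \<and> (\<forall>m\<in>root_lattice. E (\<psi> m) d = inner m p / lam)"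
proof -
  define \<pi> where "\<pi> x = (SOME m. m \<in> root_lattice \<and> (\<exists>l\<in>L2. x = \<psi> m \<oplus>\<^sub>V l))" for x
  have pi: "\<pi> (\<psi> m \<oplus>\<^sub>V l) = m" if "m \<in> root_lattice" "l \<in> L2" for m l
    unfolding \<pi>_def using that decomposition_unique by (intro some_equality) blast+
  have pi_add: "\<pi> (x \<oplus>\<^sub>V y) = \<pi> x + \<pi> y \<and> \<pi> x \<in> root_lattice \<and> \<pi> y \<in> root_lattice"
    if xy: "x \<in> lattice X" "y \<in> lattice X" for x y
  proof -
    obtain m k m' k' where x: "m \<in> root_lattice" "k \<in> L2" "x = \<psi> m \<oplus>\<^sub>V k"
      and y: "m' \<in> root_lattice" "k' \<in> L2" "y = \<psi> m' \<oplus>\<^sub>V k'"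
      using xy unfolding lattice_iff by blast
    have "x \<oplus>\<^sub>V y = \<psi> (m + m') \<oplus>\<^sub>V (k \<oplus>\<^sub>V k')"
      using x y psi_add psi_V L2_V by (simp add: V.M.a_ac)
    moreover have "k \<oplus>\<^sub>V k' \<in> L2" using L2 x y by (simp add: additive_subgroup.a_closed)
    ultimately show ?thesis using pi x y root_lattice_closed(2) by auto
  qed
  define \<phi> where "\<phi> x = - \<lfloor>inner (\<pi> x) p / lam\<rfloor>" for x
  have int: "of_int \<lfloor>inner m p / lam\<rfloor> = inner m p / lam" if "m \<in> root_lattice" for m
    using pairing_integral[OF that p] by simp
  have "\<phi> (x \<oplus>\<^sub>V y) = \<phi> x + \<phi> y" if "x \<in> lattice X" "y \<in> lattice X" for x y
    using pi_add[OF that] pairing_integral[OF _ p]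
    by (auto simp: \<phi>_def inner_add_left add_divide_distrib elim!: Ints_cases)
  from unimodular[OF this] obtain y where y: "y \<in> lattice X" "\<And>x. x \<in> lattice X \<Longrightarrow> E y x = of_int (\<phi> x)"
    by blast
  obtain m0 d where md: "m0 \<in> root_lattice" "d \<in> L2" "y = \<psi> m0 \<oplus>\<^sub>V d" using y(1) by (auto simp: lattice_iff)
  have "E (\<psi> m) d = inner m p / lam" if m: "m \<in> root_lattice" for m
  proof -
    have "\<pi> (\<psi> m) = m"
      using pi[OF m additive_subgroup.zero_closed[OF L2]] psi_V[OF m] by simp
    then have "E y (\<psi> m) = - (inner m p / lam)"
      using y(2)[OF psi_in_lattice[OF m]] int[OF m] by (simp add: \<phi>_def)
    moreover have "E (\<psi> m) y = E (\<psi> m) d"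
      using m md psi_V L2_V E_psi_psi by (simp add: H_add)
    ultimately show ?thesis using E_antisym[of y "\<psi> m"] y(1) lattice_V psi_V[OF m] by simp
  qed
  then show ?thesis using md(2) L2_nondegenerate by (intro ex1I[of _ d]) auto
qed

definition dual_psi :: "'e \<Rightarrow> 'v" where
  "dual_psi p = (THE d. d \<in> L2 \<and> (\<forall>m\<in>root_lattice. E (\<psi> m) d = inner m p / lam))"

lemma dual_psi_L2: "p \<in> dual_lattice \<Longrightarrow> dual_psi p \<in> L2"
  and E_psi_dual_psi: "p \<in> dual_lattice \<Longrightarrow> m \<in> root_lattice \<Longrightarrow> E (\<psi> m) (dual_psi p) = inner m p / lam"
  using theI'[OF ex_dual_vector] unfolding dual_psi_def by auto

lemma dual_psi_eqI:
  "p \<in> dual_lattice \<Longrightarrow> d \<in> L2 \<Longrightarrow> (\<And>m. m \<in> root_lattice \<Longrightarrow> E (\<psi> m) d = inner m p / lam) \<Longrightarrow> dual_psi p = d"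
  using L2_nondegenerate dual_psi_L2 E_psi_dual_psi by simp

lemma dual_psi_V: "p \<in> dual_lattice \<Longrightarrow> dual_psi p \<in> V"
  using dual_psi_L2 L2_V by blast

lemma dual_psi_add:
  assumes "p \<in> dual_lattice" "q \<in> dual_lattice"
  shows "dual_psi (p + q) = dual_psi p \<oplus>\<^sub>V dual_psi q"
  using assms dual_lattice_closed(2) dual_psi_L2 L2 psi_V dual_psi_V E_psi_dual_psi
  by (intro dual_psi_eqI) (auto simp: additive_subgroup.a_closed H_add inner_add_right add_divide_distrib)

text \<open>Hence the second summand is a copy of the dual lattice: a vector of it is recovered from its
  pairings with the images of the simple roots.\<close>

lemma L2_eq: "L2 = dual_psi ` dual_lattice"
proof
  show "dual_psi ` dual_lattice \<subseteq> L2" using dual_psi_L2 by blast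
  show "L2 \<subseteq> dual_psi ` dual_lattice"
  proof
    fix l assume l: "l \<in> L2"
    define p where "p = (\<Sum>i<n. E (\<psi> (b i)) l *\<^sub>R dual i)"
    have pc: "dual_coord p i = E (\<psi> (b i)) l" if "i < n" for i
      using that by (simp add: p_def dual_coord_sum if_distrib cong: if_cong)
    then have p: "p \<in> dual_lattice"
      using l E_integral psi_in_lattice b_in_root_lattice L2_in_lattice by (auto simp: dual_lattice_def)
    have "E (\<psi> m) l = inner m p / lam" if m: "m \<in> root_lattice" for m
    proof -
      have "- E l (\<psi> m) = (\<Sum>i<n. coord m i *\<^sub>R - E l (\<psi> (b i)))"
        by (rule root_lattice_additive[OF _ m]) (use l L2_V psi_V in \<open>simp add: psi_add H_add\<close>)
      then have "E (\<psi> m) l = (\<Sum>i<n. coord m i *\<^sub>R E (\<psi> (b i)) l)"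
        using E_antisym[OF L2_V[OF l]] psi_V m b_in_root_lattice by simp
      then show ?thesis by (simp add: inner_coord pc)
    qed
    then have "dual_psi p = l" using p l by (intro dual_psi_eqI)
    then show "l \<in> dual_psi ` dual_lattice" using p by blast
  qed
qed

lemma T_aut:
  assumes "g \<in> carrier W"
  shows "bij_betw (T g) V V" and "T g \<in> module_hom class_ring (tangent X) (tangent X)"
    and "\<And>u v. u \<in> V \<Longrightarrow> v \<in> V \<Longrightarrow> H (T g u) (T g v) = H u v"
proof -
  have "T g \<in> carrier (ppav_aut X)" using T_hom assms by (auto simp: hom_def)
  then have "ppav_iso (T g) X X" by (simp add: ppav_aut_def)
  then show "bij_betw (T g) V V" and "T g \<in> module_hom class_ring (tangent X) (tangent X)"
    and "\<And>u v. u \<in> V \<Longrightarrow> v \<in> V \<Longrightarrow> H (T g u) (T g v) = H u v"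
    by (auto simp: ppav_iso_def)
qed

lemma T_V: "g \<in> carrier W \<Longrightarrow> v \<in> V \<Longrightarrow> T g v \<in> V"
  using T_aut(1) by (auto simp: bij_betw_def)

lemma T_add: "g \<in> carrier W \<Longrightarrow> u \<in> V \<Longrightarrow> v \<in> V \<Longrightarrow> T g (u \<oplus>\<^sub>V v) = T g u \<oplus>\<^sub>V T g v"
  and T_smult: "g \<in> carrier W \<Longrightarrow> v \<in> V \<Longrightarrow> T g (c \<odot>\<^sub>V v) = c \<odot>\<^sub>V T g v"
  using T_aut(2) by (auto simp: module_hom_def)

lemma dual_psi_equivariant:
  assumes g: "g \<in> carrier W" and p: "p \<in> dual_lattice"
  shows "dual_psi (g p) = T g (dual_psi p)"
proof (rule dual_psi_eqI)
  show "g p \<in> dual_lattice" using weyl_dual_lattice[OF g] p by blast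
  show "T g (dual_psi p) \<in> L2" using invariant[OF g] dual_psi_L2[OF p] by blast
  fix m assume "m \<in> root_lattice"
  then obtain m' where m': "m' \<in> root_lattice" "m = g m'" using weyl_root_lattice[OF g] by blast
  then show "E (\<psi> m) (T g (dual_psi p)) = inner m (g p) / lam"
    using psi_equivariant[OF g m'(1)] T_aut(3)[OF g psi_V[OF m'(1)] dual_psi_V[OF p]]
    by (simp add: E_psi_dual_psi p weyl_inner[OF g])
qed

lemma rlin_T:
  assumes F: "rlin F" and g: "g \<in> carrier W"
  shows "rlin (\<lambda>x. T g (F x))"
proof -
  have "linear (\<lambda>x. H u (T g (F x)))" if "u \<in> V" for u
  proof -
    have "u \<in> T g ` V" using T_aut(1)[OF g] that by (simp add: bij_betw_def)
    then obtain u' where u': "u' \<in> V" "u = T g u'" by blast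
    then have "H u (T g (F x)) = H u' (F x)" for x using T_aut(3)[OF g] rlin_closed[OF F] by blast
    then show ?thesis using rlin_H[OF F u'(1)] by simp
  qed
  then show ?thesis using T_V[OF g] rlin_closed[OF F] by (simp add: rlin_def)
qed

lemma rlin_weyl:
  assumes F: "rlin F" and g: "g \<in> carrier W"
  shows "rlin (\<lambda>x. F (g x))"
  using F linear_compose[OF weyl_linear[OF g]] by (auto simp: rlin_def o_def)

lemma rlin_add: "rlin F \<Longrightarrow> F (x + y) = F x \<oplus>\<^sub>V F y"
  by (rule H_nondegenerate) (simp_all add: rlin_closed H_add linear_add[OF rlin_H])

lemma E_rlin:
  assumes "rlin F" "rlin F'"
  shows "linear (\<lambda>y. E (F x) (F' y))" "linear (\<lambda>x. E (F x) (F' y))"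
proof -
  have *: "linear (\<lambda>y. E u (F y))" if "rlin F" "u \<in> V" for u F
    using linear_add[OF rlin_H[OF that]] linear_scale[OF rlin_H[OF that]] by (intro linearI) simp_all
  show "linear (\<lambda>y. E (F x) (F' y))" using * assms rlin_closed by blast
  have "linear (\<lambda>x. - E (F' y) (F x))"
    using * assms rlin_closed by (intro linear_compose_neg) blast
  moreover have "(\<lambda>x. E (F x) (F' y)) = (\<lambda>x. - E (F' y) (F x))"
    using assms rlin_closed by (intro ext E_antisym) blast+
  ultimately show "linear (\<lambda>x. E (F x) (F' y))" by simp
qed

text \<open>The real linear extensions of the two lattice isomorphisms to the Euclidean space.\<close>

definition Psi :: "'e \<Rightarrow> 'v" where
  "Psi = (SOME F. rlin F \<and> (\<forall>m\<in>root_lattice. F m = \<psi> m))"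

definition Delta :: "'e \<Rightarrow> 'v" where
  "Delta = (SOME F. rlin F \<and> (\<forall>p\<in>dual_lattice. F p = dual_psi p))"

lemma Psi: "rlin Psi" "m \<in> root_lattice \<Longrightarrow> Psi m = \<psi> m"
proof -
  have "\<exists>F. rlin F \<and> (\<forall>m\<in>root_lattice. F m = \<psi> m)"
    using extend_from_root_lattice[of \<psi>] psi_V psi_add by metis
  from someI_ex[OF this, folded Psi_def] show "rlin Psi" "m \<in> root_lattice \<Longrightarrow> Psi m = \<psi> m"
    by blast+
qed

lemma Delta: "rlin Delta" "p \<in> dual_lattice \<Longrightarrow> Delta p = dual_psi p"
proof -
  have "\<exists>F. rlin F \<and> (\<forall>m\<in>dual_lattice. F m = dual_psi m)"
    using extend_from_dual_lattice[of dual_psi] dual_psi_V dual_psi_add by metis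
  from someI_ex[OF this, folded Delta_def] show "rlin Delta" "p \<in> dual_lattice \<Longrightarrow> Delta p = dual_psi p"
    by blast+
qed

lemmas Psi_V [simp] = rlin_closed[OF Psi(1)]
lemmas Delta_V [simp] = rlin_closed[OF Delta(1)]

lemma Psi_equivariant: "g \<in> carrier W \<Longrightarrow> T g (Psi x) = Psi (g x)"
proof (rule rlin_eqI_b[of "\<lambda>x. T g (Psi x)" "\<lambda>x. Psi (g x)"])
  fix i assume g: "g \<in> carrier W" and "i < n"
  then have "b i \<in> root_lattice" "g (b i) \<in> root_lattice"
    using b_in_root_lattice weyl_root_lattice by blast+
  then show "T g (Psi (b i)) = Psi (g (b i))" using g by (simp add: Psi(2) psi_equivariant)
qed (use rlin_T rlin_weyl Psi in auto)

lemma Delta_equivariant: "g \<in> carrier W \<Longrightarrow> T g (Delta x) = Delta (g x)"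
proof (rule rlin_eqI_dual[of "\<lambda>x. T g (Delta x)" "\<lambda>x. Delta (g x)"])
  fix i assume g: "g \<in> carrier W" and "i < n"
  then have "dual i \<in> dual_lattice" "g (dual i) \<in> dual_lattice"
    using dual_in_dual_lattice weyl_dual_lattice by blast+
  then show "T g (Delta (dual i)) = Delta (g (dual i))" using g by (simp add: Delta(2) dual_psi_equivariant)
qed (use rlin_T rlin_weyl Delta in auto)

lemma E_Psi_Psi: "E (Psi x) (Psi y) = 0"
proof -
  have "E (Psi (b i)) (Psi y) = 0" if "i < n" for i
  proof -
    have "E (Psi (b i)) (Psi y) = (\<Sum>j<n. coord y j *\<^sub>R E (Psi (b i)) (Psi (b j)))"
      by (rule linear_b_expansion[OF E_rlin(1)[OF Psi(1) Psi(1)]])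
    then show ?thesis using that by (simp add: Psi(2) b_in_root_lattice E_psi_psi)
  qed
  moreover have "E (Psi x) (Psi y) = (\<Sum>i<n. coord x i *\<^sub>R E (Psi (b i)) (Psi y))"
    by (rule linear_b_expansion[OF E_rlin(2)[OF Psi(1) Psi(1)]])
  ultimately show ?thesis by simp
qed

lemma E_Delta_Delta: "E (Delta x) (Delta y) = 0"
proof -
  have "E (Delta (dual i)) (Delta y) = 0" if "i < n" for i
  proof -
    have "E (Delta (dual i)) (Delta y) = (\<Sum>j<n. dual_coord y j *\<^sub>R E (Delta (dual i)) (Delta (dual j)))"
      by (rule linear_dual_expansion[OF E_rlin(1)[OF Delta(1) Delta(1)]])
    then show ?thesis using that by (simp add: Delta(2) dual_in_dual_lattice dual_psi_L2 E_L2_L2)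
  qed
  moreover have "E (Delta x) (Delta y) = (\<Sum>i<n. dual_coord x i *\<^sub>R E (Delta (dual i)) (Delta y))"
    by (rule linear_dual_expansion[OF E_rlin(2)[OF Delta(1) Delta(1)]])
  ultimately show ?thesis by simp
qed

lemma E_Psi_Delta: "E (Psi x) (Delta y) = inner x y / lam"
proof -
  have 1: "E (Psi (b i)) (Delta y) = dual_coord y i" if i: "i < n" for i
  proof -
    have "E (Psi (b i)) (Delta y) = (\<Sum>j<n. dual_coord y j *\<^sub>R E (Psi (b i)) (Delta (dual j)))"
      by (rule linear_dual_expansion[OF E_rlin(1)[OF Psi(1) Delta(1)]])
    also have "\<dots> = (\<Sum>j<n. dual_coord y j *\<^sub>R dual_coord (dual j) i)"
      using i by (simp add: Psi(2) Delta(2) b_in_root_lattice dual_in_dual_lattice E_psi_dual_psi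
          dual_coord_def inner_commute del: dual_coord_dual)
    also have "\<dots> = dual_coord y i"
      using i by (simp add: if_distrib cong: if_cong)
    finally show ?thesis .
  qed
  have "E (Psi x) (Delta y) = (\<Sum>i<n. coord x i *\<^sub>R E (Psi (b i)) (Delta y))"
    by (rule linear_b_expansion[OF E_rlin(2)[OF Psi(1) Delta(1)]])
  then show ?thesis by (simp add: 1 inner_coord)
qed

lemma E_Delta_Psi: "E (Delta y) (Psi x) = - inner x y / lam"
  using E_antisym[of "Psi x" "Delta y"] E_Psi_Delta by simp

text \<open>A real basis of \<open>V\<close> generating the lattice consists of lattice vectors, and these have the
  required form.\<close>

lemma spanning:
  assumes v: "v \<in> V"
  obtains x y where "v = Psi x \<oplus>\<^sub>V Delta y"
proof -
  obtain B where B: "real_basis (tangent X) (2 * n) B"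
    and L: "lattice X = {\<Oplus>\<^bsub>tangent X\<^esub>i\<in>{..<2 * n}. complex_of_int (k i) \<odot>\<^sub>V B i | k :: nat \<Rightarrow> int. True}"
    using ppav unfolding ppav_def full_lattice_def by (elim conjE exE)
  have BV: "B i \<in> V" if "i < 2 * n" for i using B that by (auto simp: real_basis_def)
  have "\<exists>m p. B i = Psi m \<oplus>\<^sub>V Delta p" if i: "i < 2 * n" for i
  proof -
    define k :: "nat \<Rightarrow> int" where "k = (\<lambda>j. if j = i then 1 else 0)"
    have "B i = (\<Oplus>\<^bsub>tangent X\<^esub>i\<in>{..<2 * n}. complex_of_int (k i) \<odot>\<^sub>V B i)"
    proof (rule H_nondegenerate)
      show "(\<Oplus>\<^bsub>tangent X\<^esub>i\<in>{..<2 * n}. complex_of_int (k i) \<odot>\<^sub>V B i) \<in> V"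
        using BV by (intro V.M.finsum_closed) auto
      fix u assume "u \<in> V"
      then show "H u (B i) = H u (\<Oplus>\<^bsub>tangent X\<^esub>i\<in>{..<2 * n}. complex_of_int (k i) \<odot>\<^sub>V B i)"
        using BV i by (simp add: H_finsum Pi_def H_smult k_def if_distrib if_distribR cong: if_cong)
    qed (rule BV[OF i])
    then have "B i \<in> lattice X" unfolding L by blast
    then obtain m l where ml: "m \<in> root_lattice" "l \<in> L2" "B i = \<psi> m \<oplus>\<^sub>V l"
      unfolding lattice_iff by blast
    then obtain p where "p \<in> dual_lattice" "l = dual_psi p"
      using L2_eq by blast
    with ml have "B i = Psi m \<oplus>\<^sub>V Delta p" using Psi(2) Delta(2) by simp
    then show ?thesis by blast
  qed
  then obtain m p where mp: "\<And>i. i < 2 * n \<Longrightarrow> B i = Psi (m i) \<oplus>\<^sub>V Delta (p i)" by metis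
  obtain x :: "nat \<Rightarrow> real" where x: "v = (\<Oplus>\<^bsub>tangent X\<^esub>i\<in>{..<2 * n}. complex_of_real (x i) \<odot>\<^sub>V B i)"
    using B v unfolding real_basis_def by (meson ex1_implies_ex)
  have "v = Psi (\<Sum>i<2 * n. x i *\<^sub>R m i) \<oplus>\<^sub>V Delta (\<Sum>i<2 * n. x i *\<^sub>R p i)"
  proof (rule H_nondegenerate)
    fix u assume u: "u \<in> V"
    have "H u v = (\<Sum>i<2 * n. x i *\<^sub>R H u (B i))"
      unfolding x using u BV by (simp add: H_finsum Pi_def H_smult scaleR_conv_of_real)
    also have "\<dots> = (\<Sum>i<2 * n. x i *\<^sub>R (H u (Psi (m i)) + H u (Delta (p i))))"
      using u by (intro sum.cong refl) (simp add: mp H_add)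
    also have "\<dots> = H u (Psi (\<Sum>i<2 * n. x i *\<^sub>R m i)) + H u (Delta (\<Sum>i<2 * n. x i *\<^sub>R p i))"
      by (simp add: scaleR_add_right sum.distrib linear_sum[OF rlin_H[OF Psi(1) u]] linear_sum[OF rlin_H[OF Delta(1) u]]
          linear_scale[OF rlin_H[OF Psi(1) u]] linear_scale[OF rlin_H[OF Delta(1) u]])
    finally show "H u v = H u (Psi (\<Sum>i<2 * n. x i *\<^sub>R m i) \<oplus>\<^sub>V Delta (\<Sum>i<2 * n. x i *\<^sub>R p i))"
      using u by (simp add: H_add)
  qed (use v in simp_all)
  then show thesis by (rule that)
qed

lemma H_Psi_nonzero:
  assumes "x \<noteq> 0"
  shows "H (Delta x) (Psi x) \<noteq> 0"
proof
  assume "H (Delta x) (Psi x) = 0"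
  then have "inner x x = 0" using E_Delta_Psi[of x x] lam_pos by simp
  then show False using assms by simp
qed

text \<open>The vector \<open>\<i> \<Psi> a\<close> lies in the \<open>(-1)\<close>-eigenspace of the reflection in \<open>a\<close>, so its components
  under \<open>\<Psi>\<close> and \<open>\<Delta>\<close> lie in the \<open>(-1)\<close>-eigenspace in the Euclidean space, which is spanned by \<open>a\<close>.
  The resulting equation \<open>\<i> \<Psi> a = r \<Psi> a + q \<Delta> a\<close> with real \<open>r\<close> and \<open>q\<close> can be solved for \<open>\<Delta> a\<close>
  because \<open>\<i>\<close> is not real.\<close>

lemma Delta_multiple_Psi:
  assumes i: "i < n"
  shows "\<exists>c. \<forall>u\<in>V. H u (Delta (b i)) = c * H u (Psi (b i))"
proof -
  let ?s = "reflection (b i)" and ?v = "\<i> \<odot>\<^sub>V Psi (b i)"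
  have s: "?s \<in> carrier W" by (rule reflection_in_weyl[OF i])
  have bi: "b i \<noteq> 0" by (rule b_nonzero[OF i])
  obtain x y where v: "?v = Psi x \<oplus>\<^sub>V Delta y" by (rule spanning[of ?v]) simp
  have "T ?s ?v = \<i> \<odot>\<^sub>V Psi (- b i)"
    using s bi by (simp add: T_smult Psi_equivariant reflection_def scaleR_2)
  moreover have "T ?s ?v = Psi (?s x) \<oplus>\<^sub>V Delta (?s y)"
    using s by (simp add: v T_add Psi_equivariant Delta_equivariant)
  ultimately have eq: "\<i> \<odot>\<^sub>V Psi (- b i) = Psi (?s x) \<oplus>\<^sub>V Delta (?s y)" by simp
  have Hv: "\<i> * H u (Psi (b i)) = H u (Psi x) + H u (Delta y)" if "u \<in> V" for u
    using arg_cong[OF v, of "H u"] that by (simp add: H_smult H_add)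
  have sum0: "H u (Psi (?s x + x)) + H u (Delta (?s y + y)) = 0" if u: "u \<in> V" for u
  proof -
    have "- (\<i> * H u (Psi (b i))) = H u (Psi (?s x)) + H u (Delta (?s y))"
      using arg_cong[OF eq, of "H u"] u linear_neg[OF rlin_H[OF Psi(1) u]] by (simp add: H_smult H_add)
    then have "H u (Psi (?s x)) + H u (Delta (?s y)) + (H u (Psi x) + H u (Delta y)) = 0"
      unfolding Hv[OF u, symmetric] by (metis add.left_inverse)
    then show ?thesis
      using u by (simp add: H_add rlin_add[OF Psi(1)] rlin_add[OF Delta(1)] ac_simps)
  qed
  have "inner (?s y + y) (?s y + y) = 0"
    using arg_cong[OF sum0[of "Psi (?s y + y)"], of Im] lam_pos by (simp add: E_Psi_Psi E_Psi_Delta del: inner_add_left)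
  then have y: "y = (inner y (b i) / inner (b i) (b i)) *\<^sub>R b i"
    using bi by (intro reflection_eigenvector) simp_all
  have "inner (?s x + x) (?s x + x) = 0"
    using arg_cong[OF sum0[of "Delta (?s x + x)"], of Im] lam_pos by (simp add: E_Delta_Delta E_Delta_Psi del: inner_add_left)
  then have x: "x = (inner x (b i) / inner (b i) (b i)) *\<^sub>R b i"
    using bi by (intro reflection_eigenvector) simp_all
  obtain r q :: real where rq: "x = r *\<^sub>R b i" "y = q *\<^sub>R b i" using x y by metis
  have key: "(\<i> - of_real r) * H u (Psi (b i)) = of_real q * H u (Delta (b i))" if u: "u \<in> V" for u
    using Hv[OF u] linear_scale[OF rlin_H[OF Psi(1) u]] linear_scale[OF rlin_H[OF Delta(1) u]]
    by (simp add: rq scaleR_conv_of_real algebra_simps)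
  have nz: "\<i> - of_real r \<noteq> 0" by (simp add: complex_eq_iff)
  have "q \<noteq> 0"
    using key[of "Delta (b i)"] nz H_Psi_nonzero[OF bi] by auto
  then show ?thesis
    using key by (intro exI[of _ "(\<i> - of_real r) / of_real q"]) (auto simp: field_simps)
qed

text \<open>Apply the reflection in \<open>b j\<close> to \<open>\<Delta> (b i) = c i \<Psi> (b i)\<close> and compare the multiples of
  \<open>b j\<close> on both sides: if \<open>b i\<close> and \<open>b j\<close> are not orthogonal, then \<open>c i = c j\<close>.\<close>

lemma Delta_eq_tau_Psi: "\<exists>\<tau>. \<forall>x. Delta x = \<tau> \<odot>\<^sub>V Psi x"
proof -
  obtain c where c: "\<And>i u. i < n \<Longrightarrow> u \<in> V \<Longrightarrow> H u (Delta (b i)) = c i * H u (Psi (b i))"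
    using Delta_multiple_Psi by metis
  have adj: "c i = c j" if ij: "i < n" "j < n" and nz: "inner (b i) (b j) \<noteq> 0" for i j
  proof -
    let ?s = "reflection (b j)"
    define k where "k = 2 * inner (b i) (b j) / inner (b j) (b j)"
    have bj: "b j \<noteq> 0" by (rule b_nonzero[OF ij(2)])
    then have k: "k \<noteq> 0" using nz by (simp add: k_def)
    have s: "?s \<in> carrier W" by (rule reflection_in_weyl[OF ij(2)])
    have sb: "?s (b i) = b i - k *\<^sub>R b j" by (simp add: reflection_def k_def)
    have D: "Delta (b i) = c i \<odot>\<^sub>V Psi (b i)"
      by (rule H_nondegenerate) (use c ij in \<open>simp_all add: H_smult\<close>)
    have "Delta (?s (b i)) = c i \<odot>\<^sub>V Psi (?s (b i))"
      using arg_cong[OF D, of "T ?s"] s by (simp add: Delta_equivariant Psi_equivariant T_smult)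
    then have eq: "H u (Delta (b i - k *\<^sub>R b j)) = c i * H u (Psi (b i - k *\<^sub>R b j))" if "u \<in> V" for u
      using that by (simp add: sb H_smult)
    let ?u = "Delta (b j)"
    have diff: "H ?u (Delta (b i)) - k *\<^sub>R H ?u (Delta (b j)) = c i * (H ?u (Psi (b i)) - k *\<^sub>R H ?u (Psi (b j)))"
      using eq[of ?u] linear_diff[OF rlin_H[OF Psi(1), of ?u]] linear_scale[OF rlin_H[OF Psi(1), of ?u]]
        linear_diff[OF rlin_H[OF Delta(1), of ?u]] linear_scale[OF rlin_H[OF Delta(1), of ?u]] by simp
    have cancel: "x * (p - q) * t = 0" if "p * r - x * (q * t) = p * (r - x * t)" for p q r t x :: complex
      using that by (simp add: algebra_simps)
    have "of_real k * (c i - c j) * H ?u (Psi (b j)) = 0"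
      by (rule cancel[OF diff[unfolded c[OF ij(1) Delta_V] c[OF ij(2) Delta_V] scaleR_conv_of_real]])
    then show ?thesis using k H_Psi_nonzero[OF bj] by simp
  qed
  have c0: "c i = c 0" if "i < n" for i
    using connected[of "\<lambda>i. c i = c 0", OF _ _ that] adj by simp
  have rl: "rlin (\<lambda>x. c 0 \<odot>\<^sub>V Psi x)"
    unfolding rlin_def
  proof (intro conjI ballI allI)
    fix u assume "u \<in> V"
    then show "linear (\<lambda>x. H u (c 0 \<odot>\<^sub>V Psi x))"
      using linear_add[OF rlin_H[OF Psi(1)]] linear_scale[OF rlin_H[OF Psi(1)]]
      by (auto intro!: linearI simp: H_smult distrib_left)
  qed simp
  have "Delta x = c 0 \<odot>\<^sub>V Psi x" for x
  proof (rule rlin_eqI_b[OF Delta(1) rl])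
    fix i assume i: "i < n"
    show "Delta (b i) = c 0 \<odot>\<^sub>V Psi (b i)"
      by (rule H_nondegenerate) (simp_all add: H_smult c[OF i] c0[OF i])
  qed
  then show ?thesis by blast
qed

definition tau :: complex where "tau = (SOME \<tau>. \<forall>x. Delta x = \<tau> \<odot>\<^sub>V Psi x)"

lemma Delta_tau: "Delta x = tau \<odot>\<^sub>V Psi x"
  using someI_ex[OF Delta_eq_tau_Psi] unfolding tau_def by blast

text \<open>The form is real on the image of \<open>\<Psi>\<close> by isotropy, so the symplectic pairing of \<open>\<Psi> x\<close> with
  \<open>\<tau> \<Psi> y\<close> only sees \<open>Im \<tau>\<close>.\<close>

lemma Im_tau_H: "Im tau * Re (H (Psi x) (Psi y)) = inner x y / lam"
  using E_Psi_Delta[of x y] E_Psi_Psi[of x y] by (simp add: Delta_tau H_smult)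

lemma Im_tau_pos: "0 < Im tau"
proof -
  have b0: "b 0 \<noteq> 0" using b_nonzero n_pos by blast
  have "Psi (b 0) \<noteq> \<zero>\<^bsub>tangent X\<^esub>"
    using H_Psi_nonzero[OF b0] H_zero[of "Delta (b 0)"] by auto
  then have "Re (H (Psi (b 0)) (Psi (b 0))) > 0" by (simp add: H_positive)
  moreover have "Im tau * Re (H (Psi (b 0)) (Psi (b 0))) > 0"
    using b0 lam_pos by (simp add: Im_tau_H)
  ultimately show ?thesis by (simp add: zero_less_mult_iff)
qed

lemma H_Psi_Psi: "H (Psi x) (Psi y) = of_real (inner x y / (lam * Im tau))"
  using Im_tau_H[of x y] E_Psi_Psi[of x y] Im_tau_pos by (simp add: complex_eq_iff field_simps)

end

section \<open>The Riemann matrix of a decomposable abelian variety\<close>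

lemma module_vec_module: "Module.module class_ring (module_vec TYPE(complex) n)"
proof -
  interpret vec_space "TYPE(complex)" n .
  show ?thesis by unfold_locales
qed

context decomposed_ppav
begin

interpretation rf: riemann_frame R n \<alpha> Z lam tau
  using Im_tau_pos by unfold_locales

lemma H_add_left: "u \<in> V \<Longrightarrow> v \<in> V \<Longrightarrow> w \<in> V \<Longrightarrow> H (u \<oplus>\<^sub>V v) w = H u w + H v w"
  by (simp add: H_cnj[of w] H_add)

lemma H_smult_left: "v \<in> V \<Longrightarrow> w \<in> V \<Longrightarrow> H (c \<odot>\<^sub>V v) w = cnj c * H v w"
  by (simp add: H_cnj[of w] H_smult)

text \<open>The complex linear extension of \<open>\<Psi>\<close> to the complexification of the Euclidean space.\<close>

definition from_coords :: "complex vec \<Rightarrow> 'v" where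
  "from_coords v = Psi (re_part v) \<oplus>\<^sub>V \<i> \<odot>\<^sub>V Psi (im_part v)"

lemma from_coords_V [simp]: "from_coords v \<in> V"
  by (simp add: from_coords_def)

lemma H_Psi_linear:
  "u \<in> V \<Longrightarrow> H u (Psi (x + y)) = H u (Psi x) + H u (Psi y)"
  "u \<in> V \<Longrightarrow> H u (Psi (x - y)) = H u (Psi x) - H u (Psi y)"
  "u \<in> V \<Longrightarrow> H u (Psi (r *\<^sub>R x)) = of_real r * H u (Psi x)"
  using linear_add[OF rlin_H[OF Psi(1)]] linear_diff[OF rlin_H[OF Psi(1)]] linear_scale[OF rlin_H[OF Psi(1)]]
  by (simp_all add: scaleR_conv_of_real)

lemma H_from_coords: "u \<in> V \<Longrightarrow> H u (from_coords (cvec x y)) = H u (Psi x) + \<i> * H u (Psi y)"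
  by (simp add: from_coords_def H_add H_smult)

text \<open>Here \<open>\<Delta> = \<tau> \<Psi>\<close> is used: the vector \<open>m + \<tau> p\<close> goes to \<open>\<Psi> m + \<Delta> p\<close>, so that the lattices
  correspond.\<close>

lemma from_coords_lat: "from_coords (rf.lat m p) = Psi m \<oplus>\<^sub>V Delta p"
proof (rule H_nondegenerate)
  fix u assume "u \<in> V"
  then show "H u (from_coords (rf.lat m p)) = H u (Psi m \<oplus>\<^sub>V Delta p)"
    by (simp add: rf.lat_def H_from_coords H_add H_smult Delta_tau H_Psi_linear complex_eq_iff)
qed simp_all

lemma from_coords_iso: "ppav_iso from_coords rf.X X"
  unfolding ppav_iso_def rf.tangent_X
proof (intro conjI ballI)
  show "from_coords \<in> module_hom class_ring (module_vec TYPE(complex) n) (tangent X)"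
    unfolding module_hom_def module_vec_simps
  proof (intro CollectI conjI allI impI)
    fix v w :: "complex vec" assume "v \<in> carrier_vec n \<and> w \<in> carrier_vec n"
    then obtain x y x' y' where vw: "v = cvec x y" "w = cvec x' y'" by (meson cvec_cases)
    show "from_coords (v + w) = from_coords v \<oplus>\<^sub>V from_coords w"
      by (rule H_nondegenerate)
        (simp_all add: vw H_from_coords H_add H_Psi_linear algebra_simps)
  next
    fix c :: complex and v :: "complex vec" assume "c \<in> carrier class_ring \<and> v \<in> carrier_vec n"
    then obtain x y where v: "v = cvec x y" by (meson cvec_cases)
    show "from_coords (c \<cdot>\<^sub>v v) = c \<odot>\<^sub>V from_coords v"
      by (rule H_nondegenerate)
        (simp_all add: v H_from_coords H_smult H_Psi_linear complex_eq_iff algebra_simps)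
  qed simp
  show herm: "H (from_coords u) (from_coords v) = herm rf.X u v"
    if "u \<in> carrier (module_vec TYPE(complex) n)" "v \<in> carrier (module_vec TYPE(complex) n)" for u v
  proof -
    from that obtain x y x' y' where uv: "u = cvec x y" "v = cvec x' y'"
      unfolding module_vec_simps by (meson cvec_cases)
    show ?thesis
      unfolding uv rf.herm_cvec
      by (simp add: from_coords_def H_add H_smult H_add_left H_smult_left H_Psi_Psi complex_eq_iff
          add_divide_distrib diff_divide_distrib)
  qed
  show "bij_betw from_coords (carrier (module_vec TYPE(complex) n)) V"
    unfolding module_vec_simps
  proof (rule bij_betwI')
    fix u v :: "complex vec" assume "u \<in> carrier_vec n" "v \<in> carrier_vec n"
    then obtain x y x' y' where uv: "u = cvec x y" "v = cvec x' y'" by (meson cvec_cases)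
    have "x = x' \<and> y = y'" if eq: "from_coords u = from_coords v"
    proof -
      have H: "H (Psi z) (from_coords (cvec x y)) = Complex (inner z x) (inner z y) / of_real (lam * Im tau)" for x y z
        by (simp add: H_from_coords H_Psi_Psi complex_eq_iff)
      have "inner z x = inner z x' \<and> inner z y = inner z y'" for z
        using arg_cong[OF eq, of "H (Psi z)"] Im_tau_pos lam_pos unfolding uv H by (simp add: complex_eq_iff)
      then show ?thesis by (auto intro!: eq_if_coord_eq simp: coord_def)
    qed
    then show "from_coords u = from_coords v \<longleftrightarrow> u = v" by (auto simp: uv)
  next
    fix v assume "v \<in> V"
    then obtain x y where "v = Psi x \<oplus>\<^sub>V Delta y" by (rule spanning)
    then show "\<exists>u\<in>carrier_vec n. v = from_coords u"
      by (intro bexI[of _ "rf.lat x y"]) (simp_all add: from_coords_lat)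
  qed simp
  have lattice_X_eq: "lattice X = {Psi m \<oplus>\<^sub>V Delta p | m p. m \<in> root_lattice \<and> p \<in> dual_lattice}"
  proof (intro equalityI subsetI)
    fix v assume "v \<in> lattice X"
    then obtain m l where ml: "m \<in> root_lattice" "l \<in> L2" "v = \<psi> m \<oplus>\<^sub>V l"
      unfolding lattice_iff by blast
    moreover obtain p where "p \<in> dual_lattice" "l = dual_psi p" using ml(2) L2_eq by blast
    ultimately show "v \<in> {Psi m \<oplus>\<^sub>V Delta p | m p. m \<in> root_lattice \<and> p \<in> dual_lattice}"
      using Psi(2) Delta(2) by (intro CollectI exI[of _ m] exI[of _ p]) simp
  next
    fix v assume "v \<in> {Psi m \<oplus>\<^sub>V Delta p | m p. m \<in> root_lattice \<and> p \<in> dual_lattice}"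
    then obtain m p where "v = Psi m \<oplus>\<^sub>V Delta p" "m \<in> root_lattice" "p \<in> dual_lattice" by blast
    then show "v \<in> lattice X"
      unfolding lattice_iff using Psi(2) Delta(2) dual_psi_L2 by (intro bexI[of _ m] bexI[of _ "dual_psi p"]) simp_all
  qed
  show "from_coords ` lattice rf.X = lattice X"
  proof (rule Set.set_eqI)
    fix v
    have "v \<in> from_coords ` lattice rf.X \<longleftrightarrow> (\<exists>m\<in>root_lattice. \<exists>p\<in>dual_lattice. v = from_coords (rf.lat m p))"
      unfolding rf.lattice_X by blast
    then show "v \<in> from_coords ` lattice rf.X \<longleftrightarrow> v \<in> lattice X"
      unfolding lattice_X_eq from_coords_lat by blast
  qed
qed

theorem isomorphic_to_riemann_ppav:
  "\<exists>\<tau>\<in>upper_half_plane. ppav_isomorphic X (riemann_ppav n (\<tau> \<cdot>\<^sub>m map_mat complex_of_real Z))"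
proof (intro bexI)
  show "ppav_isomorphic X (riemann_ppav n (tau \<cdot>\<^sub>m map_mat complex_of_real Z))"
    unfolding rf.Zt_def[symmetric]
  proof (rule ppav_isomorphic_sym[OF from_coords_iso])
    show "Module.module class_ring (tangent rf.X)" unfolding rf.tangent_X by (rule module_vec_module)
    show "lattice rf.X \<subseteq> carrier (tangent rf.X)" by (auto simp: rf.lattice_X module_vec_simps)
  qed
  show "tau \<in> upper_half_plane" using Im_tau_pos by (simp add: upper_half_plane_def)
qed

end

section \<open>The family of decomposable abelian varieties\<close>

theorem proposition3p1:
  fixes T :: root_type
    and R :: "'e::euclidean_space set"
    and \<alpha> :: "nat \<Rightarrow> 'e"
    and n :: nat
  assumes "irreducible_root_system R"
    and "reduced_root_system R"
    and "bourbaki_basis T R \<alpha>"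
    and "n = type_rank T"
  shows
    "(\<forall>\<tau>\<in>upper_half_plane.
        Z_tau T \<tau> \<in> siegel_space n \<and>
        rho_decomposable n (weyl_group R) (basis_lattice n \<alpha>) (\<lambda>w x. w x)
          (riemann_ppav n (Z_tau T \<tau>))) \<and>
     (\<forall>X :: 'v polarized_torus.
        rho_decomposable n (weyl_group R) (basis_lattice n \<alpha>) (\<lambda>w x. w x) X \<longrightarrow>
        (\<exists>\<tau>\<in>upper_half_plane. ppav_isomorphic X (riemann_ppav n (Z_tau T \<tau>)))) \<and>
     (\<forall>\<tau>\<in>upper_half_plane. countable {\<tau>'\<in>upper_half_plane.
        ppav_isomorphic (riemann_ppav n (Z_tau T \<tau>)) (riemann_ppav n (Z_tau T \<tau>'))})"
proof -
  have "root_system R" using assms(2) by (simp add: reduced_root_system_def)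
  then obtain lam where "root_frame R n \<alpha> (Z0 T) lam"
    using bourbaki_basis_root_frame assms(3,4) by blast
  then interpret root_frame R n \<alpha> "Z0 T" lam .
  show ?thesis
    unfolding basis_lattice_eq
  proof (intro conjI ballI allI impI)
    fix \<tau> assume "\<tau> \<in> upper_half_plane"
    then have \<tau>: "0 < Im \<tau>" by (simp add: upper_half_plane_def)
    then interpret riemann_frame R n \<alpha> "Z0 T" lam \<tau> by unfold_locales
    have Zt: "Zt = Z_tau T \<tau>" by (simp only: Zt_def Z_tau_def)
    show "Z_tau T \<tau> \<in> siegel_space n" using siegel_Zt unfolding Zt .
    show "rho_decomposable n (weyl_group R) root_lattice (\<lambda>w x. w x) (riemann_ppav n (Z_tau T \<tau>))"
      using rho_decomposable_X unfolding Zt .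
    show "countable {\<tau>'\<in>upper_half_plane.
        ppav_isomorphic (riemann_ppav n (Z_tau T \<tau>)) (riemann_ppav n (Z_tau T \<tau>'))}"
      unfolding Z_tau_def by (rule countable_isomorphic[OF \<tau>])
  next
    fix X :: "'v polarized_torus"
    assume X: "rho_decomposable n (weyl_group R) root_lattice (\<lambda>w x. w x) X"
    then obtain S L1 L2 \<psi> where S: "S \<in> hom (weyl_group R) (ppav_aut X)"
      "additive_subgroup L1 (tangent X)" "additive_subgroup L2 (tangent X)"
      "L1 <+>\<^bsub>tangent X\<^esub> L2 = lattice X" "L1 \<inter> L2 = {\<zero>\<^bsub>tangent X\<^esub>}"
      "\<forall>g\<in>carrier (weyl_group R). S g ` L1 \<subseteq> L1 \<and> S g ` L2 \<subseteq> L2"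
      "isotropic X L1" "isotropic X L2" "bij_betw \<psi> root_lattice L1"
      "\<forall>x\<in>root_lattice. \<forall>y\<in>root_lattice. \<psi> (x + y) = \<psi> x \<oplus>\<^bsub>tangent X\<^esub> \<psi> y"
      "\<forall>g\<in>carrier (weyl_group R). \<forall>x\<in>root_lattice. \<psi> (g x) = S g (\<psi> x)"
      unfolding rho_decomposable_def by (elim conjE exE) (rule that)
    have "ppav n X" using X by (simp add: rho_decomposable_def)
    then interpret decomposed_ppav R n \<alpha> "Z0 T" lam X S L1 L2 \<psi>
      using S(1-5) S(6)[rule_format] S(7-9) S(10)[rule_format] S(11)[rule_format]
      by (rule decomposed_ppav.intro[OF root_frame_axioms decomposed_ppav_axioms.intro])
    show "\<exists>\<tau>\<in>upper_half_plane. ppav_isomorphic X (riemann_ppav n (Z_tau T \<tau>))"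
      unfolding Z_tau_def by (rule isomorphic_to_riemann_ppav)
  qed
qed

end
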